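(* Let $V$ be a valuation domain with quotient field $K$ and valuation $v$. Let $E=\{s_\nu\}_{\nu\in\Lambda}\subset K$ be a strictly pseudo-monotone sequence and let $\phi\in K(X)$ be non-constant. Then $\phi(E)=\{\phi(s_\nu)\}_{\nu\in\Lambda}$ is an eventually strictly pseudo-monotone sequence, which is of the same kind as $E$ if $\mathrm{degdom}_E(\phi)>0$, and not of the same kind as $E$ if $\mathrm{degdom}_E(\phi)<0$; if $\mathrm{degdom}_E(\phi)\neq0$, then $\mathcal L_{\phi(E)}=\mathrm{Br}(\phi(E))$. Furthermore, if $\phi(E)$ is eventually pseudo-convergent, then $\phi(X)$ is a pseudo-limit of $\phi(E)$ with respect to $v_E$.
   Context: $\overline K$ is a fixed algebraic closure of $K$. Sequences $E=\{s_\nu\}_{\nu\in\Lambda}\subset K$ are indexed by well-ordered sets $\Lambda$ without maximum. $E$ is pseudo-convergent if $v(s_\rho-s_\nu)<v(s_\sigma-s_\rho)$ for all $\nu<\rho<\sigma$; pseudo-divergent if $v(s_\rho-s_\nu)>v(s_\sigma-s_\rho)$ for all $\nu<\rho<\sigma$. $E$ is strictly pseudo-monotone if it is either pseudo-convergent or pseudo-divergent; two strictly pseudo-monotone sequences are of the same kind if both are pseudo-convergent or both pseudo-divergent. "Eventually" (strictly pseudo-monotone, pseudo-convergent, etc.) means that some tail $\{s_\nu\}_{\nu\geq N}$ has the property; for eventually pseudo-monotone sequences the notions below refer to such a tail. The gauge $\{\delta_\nu\}$ of $E$ is: $\delta_\nu=v(s_\rho-s_\nu)$ for any $\rho>\nu$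 if $E$ is pseudo-convergent; $\delta_\nu=v(s_\rho-s_\nu)$ for any $\rho<\nu$ ($\nu$ not minimal) if $E$ is pseudo-divergent. The breadth ideal is $\mathrm{Br}(E)=\{x\in K\mid v(x)>\delta_\nu\text{ for all }\nu\}$ if $E$ is pseudo-convergent and $\mathrm{Br}(E)=\{x\in K\mid v(x)>\delta_\nu\text{ for some }\nu\}$ if $E$ is pseudo-divergent. If $u$ is an extension of $v$ to a field $F\supseteq K$ (possibly $F=K$), $\alpha\in F$ is a pseudo-limit of $E$ with respect to $u$ if $u(\alpha-s_\nu)=\delta_\nu$ for all sufficiently large $\nu$; $\mathcal L_E$ is the set of pseudo-limits of $E$ in $K$. $\mathrm{degdom}_E(\phi)$ (dominating degree): fix an extension $u$ of $v$ to $\overline K$; $\mathrm{degdom}_E(\phi)$ is the number of zeros of $\phi$ in $\overline K$ that are pseudo-limits of $E$ with respect to $u$, minus the number of poles of $\phi$ in $\overline K$ that are pseudo-limits of $E$ with respect to $u$, both counted with multiplicity (this does not depend on $u$). $V_E=\{\psi\in K(X)\mid \psi(s_\nu)\in V\text{ for all sufficiently large }\nu\}$ is a valuation domain of $K(X)$ extending $V$, and $v_E$ is its valuation (extending $v$). *)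

theory Defs
  imports
    "HOL-Library.Extended"
    "HOL-Computational_Algebra.Polynomial"
    "HOL-Computational_Algebra.Fraction_Field"
    "HOL-Algebra.Algebraic_Closure_Type"
begin

section \<open>Valuations\<close>

text \<open>The type of values is the ordered group extended by \<open>\<infinity> = v 0\<close>; the library type also contains
  \<open>-\<infinity>\<close>, which is not allowed as a value.\<close>

definition is_valuation :: "('f::field \<Rightarrow> 'g::linordered_ab_group_add extended) \<Rightarrow> bool" where
  "is_valuation v \<longleftrightarrow>
     (\<forall>x. v x = \<infinity> \<longleftrightarrow> x = 0) \<and> (\<forall>x. v x \<noteq> -\<infinity>) \<and>
     (\<forall>x y. v (x * y) = v x + v y) \<and> (\<forall>x y. min (v x) (v y) \<le> v (x + y))"

text \<open>The subset \<open>V\<close> is a valuation domain with quotient field the whole type, and \<open>v\<close> is its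
  valuation (unique up to isomorphism of the value group \<open>v (K - {0})\<close>, which need not be all
  of \<open>'g\<close>).\<close>

definition valuation_domain_with ::
    "'f::field set \<Rightarrow> ('f \<Rightarrow> 'g::linordered_ab_group_add extended) \<Rightarrow> bool" where
  "valuation_domain_with V v \<longleftrightarrow> is_valuation v \<and> V = {x. 0 \<le> v x}"

text \<open>The valuation \<open>u\<close> extends \<open>v\<close> along the field embedding \<open>\<iota>\<close>. The value group of \<open>u\<close> may be larger
  than that of \<open>v\<close>, which is embedded into it by \<open>j\<close>.\<close>

definition extends_valuation ::
    "('k::field \<Rightarrow> 'g::linordered_ab_group_add extended) \<Rightarrow> ('k \<Rightarrow> 'f::field) \<Rightarrow> ('g \<Rightarrow> 'h) \<Rightarrow>
     ('f \<Rightarrow> 'h::linordered_ab_group_add extended) \<Rightarrow> bool" where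
  "extends_valuation v \<iota> j u \<longleftrightarrow>
     is_valuation u \<and> strict_mono j \<and> (\<forall>a b. j (a + b) = j a + j b) \<and>
     (\<forall>x. u (\<iota> x) = map_extended j (v x))"

section \<open>Pseudo-monotone sequences\<close>

text \<open>Sequences are functions on a type \<open>'i\<close> of class \<open>{wellorder, no_top}\<close>. The set \<open>I\<close> below is
  either \<open>UNIV\<close> or a tail \<open>{N..}\<close>.\<close>

definition pseudo_convergent_on ::
    "('k::field \<Rightarrow> 'g::linordered_ab_group_add extended) \<Rightarrow> 'i::wellorder set \<Rightarrow> ('i \<Rightarrow> 'k) \<Rightarrow> bool" where
  "pseudo_convergent_on v I s \<longleftrightarrow>
     (\<forall>\<nu>\<in>I. \<forall>\<rho>\<in>I. \<forall>\<sigma>\<in>I. \<nu> < \<rho> \<and> \<rho> < \<sigma> \<longrightarrow> v (s \<rho> - s \<nu>) < v (s \<sigma> - s \<rho>))"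

definition pseudo_divergent_on ::
    "('k::field \<Rightarrow> 'g::linordered_ab_group_add extended) \<Rightarrow> 'i::wellorder set \<Rightarrow> ('i \<Rightarrow> 'k) \<Rightarrow> bool" where
  "pseudo_divergent_on v I s \<longleftrightarrow>
     (\<forall>\<nu>\<in>I. \<forall>\<rho>\<in>I. \<forall>\<sigma>\<in>I. \<nu> < \<rho> \<and> \<rho> < \<sigma> \<longrightarrow> v (s \<rho> - s \<nu>) > v (s \<sigma> - s \<rho>))"

definition strictly_pseudo_monotone_on ::
    "('k::field \<Rightarrow> 'g::linordered_ab_group_add extended) \<Rightarrow> 'i::wellorder set \<Rightarrow> ('i \<Rightarrow> 'k) \<Rightarrow> bool" where
  "strictly_pseudo_monotone_on v I s \<longleftrightarrow> pseudo_convergent_on v I s \<or> pseudo_divergent_on v I s"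

definition eventually_pseudo_convergent ::
    "('k::field \<Rightarrow> 'g::linordered_ab_group_add extended) \<Rightarrow> ('i::{wellorder,no_top} \<Rightarrow> 'k) \<Rightarrow> bool" where
  "eventually_pseudo_convergent v s \<longleftrightarrow> (\<exists>N. pseudo_convergent_on v {N..} s)"

definition eventually_pseudo_divergent ::
    "('k::field \<Rightarrow> 'g::linordered_ab_group_add extended) \<Rightarrow> ('i::{wellorder,no_top} \<Rightarrow> 'k) \<Rightarrow> bool" where
  "eventually_pseudo_divergent v s \<longleftrightarrow> (\<exists>N. pseudo_divergent_on v {N..} s)"

definition eventually_strictly_pseudo_monotone ::
    "('k::field \<Rightarrow> 'g::linordered_ab_group_add extended) \<Rightarrow> ('i::{wellorder,no_top} \<Rightarrow> 'k) \<Rightarrow> bool" where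
  "eventually_strictly_pseudo_monotone v s \<longleftrightarrow> (\<exists>N. strictly_pseudo_monotone_on v {N..} s)"

definition same_kind ::
    "('k::field \<Rightarrow> 'g::linordered_ab_group_add extended) \<Rightarrow> ('i::{wellorder,no_top} \<Rightarrow> 'k) \<Rightarrow> ('i \<Rightarrow> 'k) \<Rightarrow> bool" where
  "same_kind v s t \<longleftrightarrow>
     eventually_pseudo_convergent v s \<and> eventually_pseudo_convergent v t \<or>
     eventually_pseudo_divergent v s \<and> eventually_pseudo_divergent v t"

text \<open>Gauge and breadth ideal of an eventually strictly pseudo-monotone sequence refer to its longest
  strictly pseudo-monotone tail; for a strictly pseudo-monotone sequence this is the whole sequence.\<close>

definition tail_start ::
    "('k::field \<Rightarrow> 'g::linordered_ab_group_add extended) \<Rightarrow> ('i::{wellorder,no_top} \<Rightarrow> 'k) \<Rightarrow> 'i" where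
  "tail_start v s = (LEAST N. strictly_pseudo_monotone_on v {N..} s)"

text \<open>The gauge is meaningful for \<open>\<nu> \<ge> tail_start v s\<close>, with strict inequality in the pseudo-divergent
  case; \<open>THE\<close> picks the common value for all admissible \<open>\<rho>\<close>.\<close>

definition gauge ::
    "('k::field \<Rightarrow> 'g::linordered_ab_group_add extended) \<Rightarrow> ('i::{wellorder,no_top} \<Rightarrow> 'k) \<Rightarrow> 'i \<Rightarrow> 'g extended" where
  "gauge v s \<nu> =
     (let N = tail_start v s in
      if pseudo_convergent_on v {N..} s
      then (THE \<delta>. \<forall>\<rho>. \<nu> < \<rho> \<longrightarrow> v (s \<rho> - s \<nu>) = \<delta>)
      else (THE \<delta>. \<forall>\<rho>. N \<le> \<rho> \<and> \<rho> < \<nu> \<longrightarrow> v (s \<rho> - s \<nu>) = \<delta>))"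

definition breadth_ideal ::
    "('k::field \<Rightarrow> 'g::linordered_ab_group_add extended) \<Rightarrow> ('i::{wellorder,no_top} \<Rightarrow> 'k) \<Rightarrow> 'k set" where
  "breadth_ideal v s =
     (let N = tail_start v s in
      if pseudo_convergent_on v {N..} s
      then {x. \<forall>\<nu>\<ge>N. v x > gauge v s \<nu>}
      else {x. \<exists>\<nu>>N. v x > gauge v s \<nu>})"

text \<open>\<open>\<alpha>\<close> is a pseudo-limit of the sequence \<open>s\<close> in \<open>K\<close> with respect to the extension \<open>u\<close> of \<open>v\<close> (along
  \<open>\<iota>\<close>, with embedding \<open>j\<close> of value groups).\<close>

definition pseudo_limit ::
    "('k::field \<Rightarrow> 'g::linordered_ab_group_add extended) \<Rightarrow> ('k \<Rightarrow> 'f::field) \<Rightarrow> ('g \<Rightarrow> 'h) \<Rightarrow>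
     ('f \<Rightarrow> 'h::linordered_ab_group_add extended) \<Rightarrow> ('i::{wellorder,no_top} \<Rightarrow> 'k) \<Rightarrow> 'f \<Rightarrow> bool" where
  "pseudo_limit v \<iota> j u s \<alpha> \<longleftrightarrow>
     (\<forall>\<^sub>F \<nu> in at_top. u (\<alpha> - \<iota> (s \<nu>)) = map_extended j (gauge v s \<nu>))"

definition pseudo_limits ::
    "('k::field \<Rightarrow> 'g::linordered_ab_group_add extended) \<Rightarrow> ('i::{wellorder,no_top} \<Rightarrow> 'k) \<Rightarrow> 'k set" where
  "pseudo_limits v s = {a. pseudo_limit v id id v s a}"

section \<open>Rational functions\<close>

text \<open>\<open>K(X)\<close> is \<open>'k poly fract\<close>. The numerator and denominator in lowest terms are determined up to a
  common nonzero constant, which affects neither values nor zeros and poles.\<close>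

definition const_fract :: "'k::field \<Rightarrow> 'k poly fract" where
  "const_fract c = Fraction_Field.Fract [:c:] 1"

definition reduced_fraction :: "'k::field poly fract \<Rightarrow> 'k poly \<times> 'k poly" where
  "reduced_fraction \<phi> =
     (SOME (p, q). q \<noteq> 0 \<and> coprime p q \<and> \<phi> = Fraction_Field.Fract p q)"

definition numerator :: "'k::field poly fract \<Rightarrow> 'k poly" where
  "numerator \<phi> = fst (reduced_fraction \<phi>)"

definition denominator :: "'k::field poly fract \<Rightarrow> 'k poly" where
  "denominator \<phi> = snd (reduced_fraction \<phi>)"

text \<open>At a pole the value is the dummy \<open>0\<close>. A strictly pseudo-monotone sequence takes each value at
  most twice, so it meets the finitely many poles only at finitely many indices and the dummy
  values do not matter eventually.\<close>

definition eval_fract :: "'k::field poly fract \<Rightarrow> 'k \<Rightarrow> 'k" where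
  "eval_fract \<phi> a = poly (numerator \<phi>) a / poly (denominator \<phi>) a"

text \<open>The number of zeros minus the number of poles, with multiplicity, among the pseudo-limits of \<open>s\<close>
  in the algebraic closure, with respect to the extension \<open>u\<close> of \<open>v\<close> (\<open>j\<close> embeds the value groups).\<close>

definition degdom ::
    "('k::field \<Rightarrow> 'g::linordered_ab_group_add extended) \<Rightarrow> ('g \<Rightarrow> 'h) \<Rightarrow>
     ('k alg_closure \<Rightarrow> 'h::linordered_ab_group_add extended) \<Rightarrow>
     ('i::{wellorder,no_top} \<Rightarrow> 'k) \<Rightarrow> 'k poly fract \<Rightarrow> int" where
  "degdom v j u s \<phi> =
     (let p = map_poly to_ac (numerator \<phi>); q = map_poly to_ac (denominator \<phi>) in
      (\<Sum>z | poly p z = 0 \<and> pseudo_limit v to_ac j u s z. int (Polynomial.order z p)) -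
      (\<Sum>z | poly q z = 0 \<and> pseudo_limit v to_ac j u s z. int (Polynomial.order z q)))"

definition sequence_ring ::
    "'k::field set \<Rightarrow> ('i::{wellorder,no_top} \<Rightarrow> 'k) \<Rightarrow> 'k poly fract set" where
  "sequence_ring V s = {\<psi>. \<forall>\<^sub>F \<nu> in at_top. eval_fract \<psi> (s \<nu>) \<in> V}"

end

theory Submission
  imports Defs
begin

text \<open>Let \<open>\<delta>\<close> be the gauge of \<open>E\<close>. If \<open>\<alpha>\<close> is a pseudo-limit of \<open>E\<close> and \<open>p = \<Sum> p\<^sub>i (X - \<alpha>)\<^sup>i\<close>, then
  the values \<open>v(p\<^sub>i) + i \<delta>\<^sub>\<nu>\<close> are affine in \<open>\<delta>\<^sub>\<nu>\<close> with different slopes, so eventually one index dominates strictly.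
  Hence, after subtracting a suitable constant \<open>c\<close>, \<open>v(\<phi>(s\<^sub>\<nu>) - c)\<close> is affine in \<open>\<delta>\<^sub>\<nu>\<close> with nonzero slope,
  which makes \<open>\<phi>(E)\<close> strictly pseudo-monotone. If \<open>degdom\<close> is nonzero, it is the slope for \<open>c = 0\<close>, as
  one sees by factoring \<open>\<phi>\<close> over the algebraic closure. Finally, if \<open>\<phi>(E)\<close> is pseudo-convergent, then
  \<open>(\<phi> - \<phi>(s\<^sub>\<nu>)) / (\<phi>(s\<^sub>\<rho>) - \<phi>(s\<^sub>\<nu>))\<close> with \<open>\<nu> < \<rho>\<close> is a unit of \<open>V\<^sub>E\<close>.\<close>

section \<open>Valuations\<close>

locale valued_field =
  fixes v :: "'f::field \<Rightarrow> 'g::linordered_ab_group_add extended"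
  assumes valuation: "is_valuation v"
begin

lemma v_eq_infinity_iff [simp]: "v x = \<infinity> \<longleftrightarrow> x = 0"
  using valuation by (simp add: is_valuation_def)

lemma v_0 [simp]: "v 0 = \<infinity>"
  by simp

lemma v_not_Minf: "v x \<noteq> -\<infinity>"
  using valuation by (simp add: is_valuation_def)

lemma v_mult: "v (x * y) = v x + v y"
  using valuation by (simp add: is_valuation_def)

lemma v_add_ge: "min (v x) (v y) \<le> v (x + y)"
  using valuation by (simp add: is_valuation_def)

lemma v_finite:
  assumes "x \<noteq> 0"
  obtains g where "v x = Fin g"
  using assms valuation by (cases "v x") (auto simp: is_valuation_def)

lemma v_less_infinity [simp]: "v x < \<infinity> \<longleftrightarrow> x \<noteq> 0"
  using v_not_Minf[of x] v_eq_infinity_iff[of x] by (cases "v x") auto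

lemma nonzero_if_v_less: "v x < v y \<Longrightarrow> x \<noteq> 0"
  by auto

lemma v_1 [simp]: "v 1 = 0"
proof -
  obtain g where "v 1 = Fin g"
    by (rule v_finite[of 1]) auto
  with v_mult[of 1 1] show ?thesis
    by (simp add: zero_extended_def)
qed

text \<open>The value \<open>g\<close> of \<open>- 1\<close> satisfies \<open>g + g = 0\<close>, and
  a linearly ordered group has no 2-torsion.\<close>

lemma v_uminus [simp]: "v (- x) = v x"
proof -
  obtain g where g: "v (- 1) = Fin g"
    by (rule v_finite[of "- 1"]) auto
  with v_mult[of "- 1" "- 1"] have "g + g = 0"
    by (simp add: zero_extended_def)
  hence "g = 0"
    by simp
  with g v_mult[of "- 1" x] show ?thesis
    by (simp flip: zero_extended_def)
qed

lemma v_diff_commute: "v (x - y) = v (y - x)"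
  using v_uminus[of "x - y"] by simp

lemma v_mult_less_cancel:
  assumes "z \<noteq> 0"
  shows "v (z * x) < v (z * y) \<longleftrightarrow> v x < v y"
proof -
  obtain g where g: "v z = Fin g"
    using assms by (rule v_finite)
  show ?thesis
    by (cases "v x"; cases "v y") (simp_all add: v_mult g v_not_Minf)
qed

lemma v_mult_cong: "v x = v x' \<Longrightarrow> v y = v y' \<Longrightarrow> v (x * y) = v (x' * y')"
  by (simp add: v_mult)

text \<open>The convention \<open>inverse 0 = 0\<close> covers the zero case; otherwise both values
  are shifted by that of \<open>inverse x * inverse y\<close>, which avoids subtracting extended
  values.\<close>

lemma v_inverse_cong:
  assumes "v x = v y"
  shows "v (inverse x) = v (inverse y)"
proof (cases "x = 0")
  case True
  hence "v y = \<infinity>" using assms by (metis v_0)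
  with True show ?thesis by simp
next
  case False
  hence y: "y \<noteq> 0" using assms by (metis v_eq_infinity_iff)
  have "v (inverse x * inverse y * y) = v (inverse x * inverse y * x)"
    using assms by (simp add: v_mult)
  thus ?thesis using False y by (simp add: field_simps)
qed

lemma v_divide_cong: "v x = v x' \<Longrightarrow> v y = v y' \<Longrightarrow> v (x / y) = v (x' / y')"
  unfolding divide_inverse by (intro v_mult_cong v_inverse_cong)

lemma v_inverse_less:
  assumes "v x < v y" and "y \<noteq> 0"
  shows "v (inverse y) < v (inverse x)"
proof -
  have x: "x \<noteq> 0"
    using assms nonzero_if_v_less by blast
  hence "v (inverse x * inverse y * x) < v (inverse x * inverse y * y)"
    using assms by (subst v_mult_less_cancel) auto
  thus ?thesis using x assms by (simp add: field_simps)
qed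

text \<open>Units of a valuation ring have value 0; this is applied to a unit of
  \<open>sequence_ring V s\<close>.\<close>

lemma v_eq_0_if_nonneg:
  assumes "0 \<le> v x" "0 \<le> v (inverse x)" "x \<noteq> 0"
  shows "v x = 0"
  using v_inverse_less[of 1 x] assms by force

lemma v_power_cong: "v x = v y \<Longrightarrow> v (x ^ n) = v (y ^ n)"
  by (induction n) (auto intro: v_mult_cong)

lemma v_power_less:
  assumes "v x < v y" and "n > 0"
  shows "v (x ^ n) < v (y ^ n)"
  using \<open>n > 0\<close>
proof (induction n rule: nat_induct_non_zero)
  case 1
  thus ?case using assms by simp
next
  case (Suc n)
  have x: "x \<noteq> 0"
    using assms nonzero_if_v_less by blast
  show ?case
  proof (cases "y = 0")
    case False
    have "v (x * x ^ n) < v (x * y ^ n)"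
      using Suc x by (simp add: v_mult_less_cancel)
    also have "\<dots> < v (y ^ n * y)"
      using False assms(1) v_mult_less_cancel[of "y ^ n" x y] by (simp add: mult.commute)
    finally show ?thesis by (simp add: mult.commute)
  qed (use x in simp)
qed

text \<open>Integer exponents occur because slopes are differences between a contribution of the
  numerator and one of the denominator.\<close>

lemma v_powi_less:
  assumes "v x < v y" and "m > 0"
  shows "v (x powi m) < v (y powi m)"
  using assms v_power_less[of x y "nat m"] by (simp add: power_int_def)

lemma v_powi_less_neg:
  assumes "v x < v y" and "y \<noteq> 0" and "m < 0"
  shows "v (y powi m) < v (x powi m)"
  using v_inverse_less[OF v_powi_less[OF assms(1), of "- m"]] assms(2,3)
  by (simp add: power_int_minus)

section \<open>Sums with a strictly dominant summand\<close>

lemma v_add_eq: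
  assumes "v x < v y"
  shows "v (x + y) = v x"
proof (rule antisym)
  show "v x \<le> v (x + y)"
    using v_add_ge[of x y] assms by (simp add: min_def split: if_splits)
  \<comment> \<open>Here \<open>x\<close> is written as \<open>(x + y) - y\<close>; the minimum
    cannot be \<open>v y\<close>, which exceeds \<open>v x\<close>.\<close>
  have "min (v (x + y)) (v y) \<le> v x"
    using v_add_ge[of "x + y" "- y"] by simp
  thus "v (x + y) \<le> v x"
    using assms by (auto simp: min_def split: if_splits)
qed

lemma v_diff_eq:
  assumes "v x < v y"
  shows "v (x - y) = v x" and "v (y - x) = v x"
  using v_add_eq[of x "- y"] assms v_diff_commute[of x y] by simp_all

text \<open>The hypothesis \<open>x \<noteq> 0\<close> provides the strict bound for the empty sum,
  whose value is \<infinity>.\<close>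

lemma v_sum_greater:
  assumes "\<And>i. i \<in> A \<Longrightarrow> v x < v (f i)" and "x \<noteq> 0"
  shows "v x < v (sum f A)"
  using assms
proof (induction A rule: infinite_finite_induct)
  case (insert i A)
  hence "v x < min (v (f i)) (v (sum f A))"
    by simp
  also have "\<dots> \<le> v (sum f (insert i A))"
    using insert v_add_ge by simp
  finally show ?case .
qed simp_all

lemma v_sum_eq_dominant:
  assumes "finite A" "k \<in> A" and "f k \<noteq> 0" and "\<And>i. i \<in> A \<Longrightarrow> i \<noteq> k \<Longrightarrow> v (f k) < v (f i)"
  shows "v (sum f A) = v (f k)"
proof -
  have "v (f k) < v (sum f (A - {k}))"
    using assms by (intro v_sum_greater) auto
  thus ?thesis
    using assms v_add_eq by (simp add: sum.remove)
qed

end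

section \<open>Ultrafilters\<close>

text \<open>Deciding every predicate, an ultrafilter settles each comparison of values along a
  family of approximate pseudo-limits, even if the field contains no actual pseudo-limit.\<close>

definition ultrafilter :: "'a filter \<Rightarrow> bool" where
  "ultrafilter F \<longleftrightarrow> F \<noteq> bot \<and> (\<forall>P. eventually P F \<or> eventually (\<lambda>x. \<not> P x) F)"

text \<open>Zorn's lemma for the proper filters below \<open>G\<close>, ordered by refinement:
  restricting a minimal one to a predicate \<open>P\<close> gives either \<open>bot\<close> or the
  same filter, so it decides \<open>P\<close>.\<close>

lemma ultrafilter_le_exists:
  assumes "G \<noteq> bot"
  obtains F where "F \<le> G" "ultrafilter F"
proof -
  let ?A = "{F. F \<le> G \<and> F \<noteq> bot}"
  have "\<exists>F\<in>?A. \<forall>H\<in>?A. F \<ge> H \<longrightarrow> H = F"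
  proof (rule predicate_Zorn)
    show "partial_order_on ?A (relation_of (\<ge>) ?A)"
      by (auto simp: partial_order_on_def preorder_on_def refl_on_def trans_def antisym_def
          relation_of_def)
    fix C assume C: "C \<in> Chains (relation_of (\<ge>) ?A)"
    show "\<exists>F\<in>?A. \<forall>H\<in>C. H \<ge> F"
    proof (cases "C = {}")
      case True
      thus ?thesis using assms by auto
    next
      case False
      have C_sub: "C \<subseteq> ?A" and C_chain: "\<And>H H'. H \<in> C \<Longrightarrow> H' \<in> C \<Longrightarrow> H \<le> H' \<or> H' \<le> H"
        using C by (auto simp: Chains_def relation_of_def)
      \<comment> \<open>A chain is directed, so \<open>Inf C\<close> contains the false predicate
        only if a member of \<open>C\<close> does; this makes the lower bound proper.\<close>
      have "\<exists>H''\<in>C. H'' \<le> inf H H'" if "H \<in> C" "H' \<in> C" for H H'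
        using C_chain[OF that] that by (auto simp: inf_absorb1 inf_absorb2)
      hence "eventually (\<lambda>_. False) (Inf C) \<longleftrightarrow> (\<exists>H\<in>C. eventually (\<lambda>_. False) H)"
        using False by (intro eventually_Inf_base) auto
      hence "Inf C \<noteq> bot"
        using C_sub by (auto simp: trivial_limit_def)
      moreover have "Inf C \<le> G"
        using False C_sub by (auto intro: Inf_lower2)
      ultimately show ?thesis
        by (intro bexI[of _ "Inf C"]) (auto intro: Inf_lower)
    qed
  qed
  then obtain F where F: "F \<le> G" "F \<noteq> bot"
    and max: "\<And>H. H \<le> G \<Longrightarrow> H \<noteq> bot \<Longrightarrow> H \<le> F \<Longrightarrow> H = F"
    by blast
  have "eventually P F \<or> eventually (\<lambda>x. \<not> P x) F" for P
  proof (cases "inf F (principal {x. P x}) = bot")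
    case True
    thus ?thesis
      by (auto simp: trivial_limit_def eventually_inf_principal)
  next
    case False
    hence "inf F (principal {x. P x}) = F"
      using F by (intro max) (auto intro: le_infI1)
    moreover have "eventually P (inf F (principal {x. P x}))"
      by (simp add: eventually_inf_principal)
    ultimately have "eventually P F"
      by simp
    thus ?thesis ..
  qed
  thus thesis
    using F that by (auto simp: ultrafilter_def)
qed

section \<open>Sequences of monotone value\<close>

context valued_field
begin

text \<open>Sequences of values are represented by field elements having these values. Sums and
  integer multiples of values thus become products and integer powers in the field.\<close>

definition increasing_from :: "'i::linorder \<Rightarrow> ('i \<Rightarrow> 'f) \<Rightarrow> bool" where
  "increasing_from N f \<longleftrightarrow> (\<forall>\<nu>\<ge>N. \<forall>\<rho>>\<nu>. v (f \<nu>) < v (f \<rho>))"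

definition decreasing_from :: "'i::linorder \<Rightarrow> ('i \<Rightarrow> 'f) \<Rightarrow> bool" where
  "decreasing_from N f \<longleftrightarrow> (\<forall>\<nu>\<ge>N. \<forall>\<rho>>\<nu>. v (f \<rho>) < v (f \<nu>))"

lemma increasing_fromD: "increasing_from N f \<Longrightarrow> N \<le> \<nu> \<Longrightarrow> \<nu> < \<rho> \<Longrightarrow> v (f \<nu>) < v (f \<rho>)"
  by (simp add: increasing_from_def)

lemma decreasing_fromD: "decreasing_from N f \<Longrightarrow> N \<le> \<nu> \<Longrightarrow> \<nu> < \<rho> \<Longrightarrow> v (f \<rho>) < v (f \<nu>)"
  by (simp add: decreasing_from_def)

lemma increasing_from_powi:
  assumes "increasing_from N t" "m > 0"
  shows "increasing_from N (\<lambda>\<nu>. t \<nu> powi m)"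
  using assms by (auto simp: increasing_from_def intro: v_powi_less)

lemma decreasing_from_powi:
  assumes "decreasing_from N t" "m > 0"
  shows "decreasing_from N (\<lambda>\<nu>. t \<nu> powi m)"
  using assms by (auto simp: decreasing_from_def intro: v_powi_less)

lemma increasing_from_powi_neg:
  assumes "increasing_from N t" "m < 0" and "\<And>\<nu>. N \<le> \<nu> \<Longrightarrow> t \<nu> \<noteq> 0"
  shows "decreasing_from N (\<lambda>\<nu>. t \<nu> powi m)"
  unfolding decreasing_from_def
  by (intro allI impI v_powi_less_neg) (use assms in \<open>auto dest: increasing_fromD\<close>)

lemma decreasing_from_powi_neg:
  assumes "decreasing_from N t" "m < 0" and "\<And>\<nu>. N \<le> \<nu> \<Longrightarrow> t \<nu> \<noteq> 0"
  shows "increasing_from N (\<lambda>\<nu>. t \<nu> powi m)"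
  unfolding increasing_from_def
  by (intro allI impI v_powi_less_neg) (use assms in \<open>auto dest: decreasing_fromD\<close>)

text \<open>A constant factor \<open>C\<close> shifts all values by the same amount. The lemma is
  applied over the algebraic closure, where \<open>C\<close> need not come from
  \<open>K\<close>.\<close>

lemma increasing_from_if_value_eq:
  fixes f g :: "'i::{wellorder,no_top} \<Rightarrow> 'f"
  assumes "increasing_from N f" "C \<noteq> 0" "\<forall>\<^sub>F \<nu> in at_top. v (g \<nu>) = v (C * f \<nu>)"
  shows "\<exists>M. increasing_from M g"
proof -
  from assms(3) eventually_ge_at_top[of N]
  have "\<forall>\<^sub>F \<nu> in at_top. N \<le> \<nu> \<and> v (g \<nu>) = v (C * f \<nu>)"
    by eventually_elim simp
  then obtain M where "\<And>\<nu>. M \<le> \<nu> \<Longrightarrow> N \<le> \<nu> \<and> v (g \<nu>) = v (C * f \<nu>)"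
    by (auto simp: eventually_at_top_linorder)
  hence "increasing_from M g"
    using assms(1,2) by (auto simp: increasing_from_def v_mult_less_cancel)
  thus ?thesis ..
qed

lemma decreasing_from_if_value_eq:
  fixes f g :: "'i::{wellorder,no_top} \<Rightarrow> 'f"
  assumes "decreasing_from N f" "C \<noteq> 0" "\<forall>\<^sub>F \<nu> in at_top. v (g \<nu>) = v (C * f \<nu>)"
  shows "\<exists>M. decreasing_from M g"
proof -
  from assms(3) eventually_ge_at_top[of N]
  have "\<forall>\<^sub>F \<nu> in at_top. N \<le> \<nu> \<and> v (g \<nu>) = v (C * f \<nu>)"
    by eventually_elim simp
  then obtain M where "\<And>\<nu>. M \<le> \<nu> \<Longrightarrow> N \<le> \<nu> \<and> v (g \<nu>) = v (C * f \<nu>)"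
    by (auto simp: eventually_at_top_linorder)
  hence "decreasing_from M g"
    using assms(1,2) by (auto simp: decreasing_from_def v_mult_less_cancel)
  thus ?thesis ..
qed

text \<open>If the values relative to \<open>c\<close> increase, a difference of two terms has the
  value of the earlier one. The centre \<open>c\<close> may depend on the triple, since an
  ultrafilter only supplies a common centre for finitely many indices at a time.\<close>

lemma pseudo_convergent_onI:
  assumes "\<And>\<nu> \<rho> \<sigma>. M \<le> \<nu> \<Longrightarrow> \<nu> < \<rho> \<Longrightarrow> \<rho> < \<sigma> \<Longrightarrow>
    \<exists>c. v (r \<nu> - c) < v (r \<rho> - c) \<and> v (r \<rho> - c) < v (r \<sigma> - c)"
  shows "pseudo_convergent_on v {M..} r"
  unfolding pseudo_convergent_on_def
proof (intro ballI impI, elim conjE)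
  fix \<nu> \<rho> \<sigma> assume "\<nu> \<in> {M..}" "\<nu> < \<rho>" "\<rho> < \<sigma>"
  then obtain c where c: "v (r \<nu> - c) < v (r \<rho> - c)" "v (r \<rho> - c) < v (r \<sigma> - c)"
    using assms[of \<nu> \<rho> \<sigma>] by auto
  show "v (r \<rho> - r \<nu>) < v (r \<sigma> - r \<rho>)"
    using v_diff_eq(2)[OF c(1)] v_diff_eq(2)[OF c(2)] c by simp
qed

text \<open>Here a difference of two terms has the value of the later one.\<close>

lemma pseudo_divergent_onI:
  assumes "\<And>\<nu> \<rho> \<sigma>. M \<le> \<nu> \<Longrightarrow> \<nu> < \<rho> \<Longrightarrow> \<rho> < \<sigma> \<Longrightarrow>
    \<exists>c. v (r \<rho> - c) < v (r \<nu> - c) \<and> v (r \<sigma> - c) < v (r \<rho> - c)"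
  shows "pseudo_divergent_on v {M..} r"
  unfolding pseudo_divergent_on_def
proof (intro ballI impI, elim conjE)
  fix \<nu> \<rho> \<sigma> assume "\<nu> \<in> {M..}" "\<nu> < \<rho>" "\<rho> < \<sigma>"
  then obtain c where c: "v (r \<rho> - c) < v (r \<nu> - c)" "v (r \<sigma> - c) < v (r \<rho> - c)"
    using assms[of \<nu> \<rho> \<sigma>] by auto
  show "v (r \<sigma> - r \<rho>) < v (r \<rho> - r \<nu>)"
    using v_diff_eq(1)[OF c(1)] v_diff_eq(1)[OF c(2)] c by simp
qed

end

section \<open>Dominant Taylor coefficients\<close>

text \<open>A summation range independent of the polynomial is wanted for families of polynomials of
  bounded degree.\<close>

lemma poly_eq_sum_le_degree:
  fixes p :: "'a::comm_semiring_1 poly"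
  assumes "degree p \<le> n"
  shows "poly p x = (\<Sum>i\<le>n. coeff p i * x ^ i)"
  unfolding poly_altdef
  by (rule sum.mono_neutral_left) (use assms in \<open>auto simp: coeff_eq_0\<close>)

text \<open>The family \<open>a\<close> along \<open>F\<close> acts as one pseudo-limit of
  \<open>s\<close>, with \<open>t\<close> carrying the distances; the set of good \<tau> may depend
  on \<nu>.\<close>

locale pseudo_approximation = valued_field v
  for v :: "'k::field \<Rightarrow> 'g::linordered_ab_group_add extended" +
  fixes s t :: "'i::{wellorder,no_top} \<Rightarrow> 'k" and a :: "'j \<Rightarrow> 'k" and F :: "'j filter" and N :: 'i
  assumes ultra: "ultrafilter F"
    and t_nonzero: "\<And>\<nu>. N \<le> \<nu> \<Longrightarrow> t \<nu> \<noteq> 0"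
    and approx: "\<And>\<nu>. N \<le> \<nu> \<Longrightarrow> \<forall>\<^sub>F \<tau> in F. v (s \<nu> - a \<tau>) = v (t \<nu>)"
    and t_monotone: "increasing_from N t \<or> decreasing_from N t"
begin

lemma F_not_bot [simp]: "F \<noteq> bot"
  using ultra by (simp add: ultrafilter_def)

lemma ultra_cases: "(\<forall>\<^sub>F \<tau> in F. P \<tau>) \<or> (\<forall>\<^sub>F \<tau> in F. \<not> P \<tau>)"
  using ultra by (simp add: ultrafilter_def)

lemma eventually_t_nonzero: "\<forall>\<^sub>F \<nu> in at_top. t \<nu> \<noteq> 0"
  using eventually_ge_at_top[of N] by eventually_elim (rule t_nonzero)

text \<open>Along the ultrafilter \<open>q\<close> defines a cut in the values, which the strictly
  monotone values of \<open>t \<nu> ^ m\<close> cross at most once; a weak inequality at one index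
  becomes strict at all later ones.\<close>

lemma compare_power:
  assumes "m > 0"
  shows "(\<forall>\<^sub>F \<nu> in at_top. \<forall>\<^sub>F \<tau> in F. v (q \<tau>) < v (t \<nu> ^ m)) \<or>
         (\<forall>\<^sub>F \<nu> in at_top. \<forall>\<^sub>F \<tau> in F. v (t \<nu> ^ m) < v (q \<tau>))"
  using t_monotone
proof
  assume inc: "increasing_from N t"
  show ?thesis
  proof (cases "\<exists>\<nu>\<ge>N. \<forall>\<^sub>F \<tau> in F. v (q \<tau>) \<le> v (t \<nu> ^ m)")
    case True
    then obtain \<nu> where \<nu>: "\<nu> \<ge> N" "\<forall>\<^sub>F \<tau> in F. v (q \<tau>) \<le> v (t \<nu> ^ m)"
      by blast
    have "\<forall>\<^sub>F \<rho> in at_top. \<forall>\<^sub>F \<tau> in F. v (q \<tau>) < v (t \<rho> ^ m)"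
      using eventually_gt_at_top[of \<nu>]
    proof eventually_elim
      case (elim \<rho>)
      hence "v (t \<nu> ^ m) < v (t \<rho> ^ m)"
        using inc \<nu> assms by (intro v_power_less) (auto dest: increasing_fromD)
      with \<nu>(2) show ?case
        by (auto elim!: eventually_mono)
    qed
    thus ?thesis ..
  next
    case False
    have "\<forall>\<^sub>F \<nu> in at_top. \<forall>\<^sub>F \<tau> in F. v (t \<nu> ^ m) < v (q \<tau>)"
      using eventually_ge_at_top[of N]
    proof eventually_elim
      case (elim \<nu>)
      with False show ?case
        using ultra_cases[of "\<lambda>\<tau>. v (q \<tau>) \<le> v (t \<nu> ^ m)"] unfolding not_le by blast
    qed
    thus ?thesis ..
  qed
next
  assume dec: "decreasing_from N t"
  show ?thesis
  proof (cases "\<exists>\<nu>\<ge>N. \<forall>\<^sub>F \<tau> in F. v (t \<nu> ^ m) \<le> v (q \<tau>)")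
    case True
    then obtain \<nu> where \<nu>: "\<nu> \<ge> N" "\<forall>\<^sub>F \<tau> in F. v (t \<nu> ^ m) \<le> v (q \<tau>)"
      by blast
    have "\<forall>\<^sub>F \<rho> in at_top. \<forall>\<^sub>F \<tau> in F. v (t \<rho> ^ m) < v (q \<tau>)"
      using eventually_gt_at_top[of \<nu>]
    proof eventually_elim
      case (elim \<rho>)
      hence "v (t \<rho> ^ m) < v (t \<nu> ^ m)"
        using dec \<nu> assms by (intro v_power_less) (auto dest: decreasing_fromD)
      with \<nu>(2) show ?case
        by (auto elim!: eventually_mono)
    qed
    thus ?thesis ..
  next
    case False
    have "\<forall>\<^sub>F \<nu> in at_top. \<forall>\<^sub>F \<tau> in F. v (q \<tau>) < v (t \<nu> ^ m)"
      using eventually_ge_at_top[of N]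
    proof eventually_elim
      case (elim \<nu>)
      with False show ?case
        using ultra_cases[of "\<lambda>\<tau>. v (t \<nu> ^ m) \<le> v (q \<tau>)"] unfolding not_le by blast
    qed
    thus ?thesis ..
  qed
qed

text \<open>The two arguments stand for terms of Taylor expansions; the dominating term is the one
  of smaller value. The set of \<tau> on which this holds may vary with \<nu>.\<close>

definition dominates :: "('j \<Rightarrow> 'k) \<Rightarrow> nat \<Rightarrow> ('j \<Rightarrow> 'k) \<Rightarrow> nat \<Rightarrow> bool" where
  "dominates b i c j \<longleftrightarrow> (\<forall>\<^sub>F \<nu> in at_top. \<forall>\<^sub>F \<tau> in F. v (b \<tau> * t \<nu> ^ i) < v (c \<tau> * t \<nu> ^ j))"

lemma dominates_trans:
  assumes "dominates b i c j" "dominates c j d k"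
  shows "dominates b i d k"
  using assms unfolding dominates_def
proof eventually_elim
  case (elim \<nu>)
  thus ?case
    by eventually_elim simp
qed

lemma dominates_zero:
  assumes "\<forall>\<^sub>F \<tau> in F. b \<tau> \<noteq> 0" "\<forall>\<^sub>F \<tau> in F. c \<tau> = 0"
  shows "dominates b i c j"
  unfolding dominates_def using eventually_t_nonzero
proof eventually_elim
  case (elim \<nu>)
  from assms show ?case
    by eventually_elim (use elim in simp)
qed

text \<open>Cancelling \<open>c \<tau> * t \<nu> ^ i\<close> leaves a comparison of
  \<open>b \<tau> / c \<tau>\<close> with the positive power \<open>t \<nu> ^ (j - i)\<close>, which
  \<open>compare_power\<close> decides.\<close>

lemma dominates_linear_aux:
  assumes "\<forall>\<^sub>F \<tau> in F. b \<tau> \<noteq> 0" "\<forall>\<^sub>F \<tau> in F. c \<tau> \<noteq> 0" and "i < j"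
  shows "dominates b i c j \<or> dominates c j b i"
proof -
  have less: "v (b \<tau> * t \<nu> ^ i) < v (c \<tau> * t \<nu> ^ j) \<longleftrightarrow> v (b \<tau> / c \<tau>) < v (t \<nu> ^ (j - i))"
       "v (c \<tau> * t \<nu> ^ j) < v (b \<tau> * t \<nu> ^ i) \<longleftrightarrow> v (t \<nu> ^ (j - i)) < v (b \<tau> / c \<tau>)"
    if "c \<tau> \<noteq> 0" "t \<nu> \<noteq> 0" for \<nu> \<tau>
  proof -
    have "b \<tau> * t \<nu> ^ i = c \<tau> * t \<nu> ^ i * (b \<tau> / c \<tau>)"
         "c \<tau> * t \<nu> ^ j = c \<tau> * t \<nu> ^ i * t \<nu> ^ (j - i)"
      using that \<open>i < j\<close> by (simp_all add: power_add[symmetric] mult.assoc)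
    thus "v (b \<tau> * t \<nu> ^ i) < v (c \<tau> * t \<nu> ^ j) \<longleftrightarrow> v (b \<tau> / c \<tau>) < v (t \<nu> ^ (j - i))"
       "v (c \<tau> * t \<nu> ^ j) < v (b \<tau> * t \<nu> ^ i) \<longleftrightarrow> v (t \<nu> ^ (j - i)) < v (b \<tau> / c \<tau>)"
      using that by (simp_all only: v_mult_less_cancel power_not_zero no_zero_divisors not_False_eq_True)
  qed
  have "j - i > 0"
    using \<open>i < j\<close> by simp
  from compare_power[OF this, of "\<lambda>\<tau>. b \<tau> / c \<tau>"] show ?thesis
  proof
    assume "\<forall>\<^sub>F \<nu> in at_top. \<forall>\<^sub>F \<tau> in F. v (b \<tau> / c \<tau>) < v (t \<nu> ^ (j - i))"
    hence "dominates b i c j"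
      unfolding dominates_def using eventually_t_nonzero
    proof eventually_elim
      case (elim \<nu>)
      from elim(1) assms(2) show ?case
        by eventually_elim (use elim less in blast)
    qed
    thus ?thesis ..
  next
    assume "\<forall>\<^sub>F \<nu> in at_top. \<forall>\<^sub>F \<tau> in F. v (t \<nu> ^ (j - i)) < v (b \<tau> / c \<tau>)"
    hence "dominates c j b i"
      unfolding dominates_def using eventually_t_nonzero
    proof eventually_elim
      case (elim \<nu>)
      from elim(1) assms(2) show ?case
        by eventually_elim (use elim less in blast)
    qed
    thus ?thesis ..
  qed
qed

lemma dominates_linear:
  assumes "\<forall>\<^sub>F \<tau> in F. b \<tau> \<noteq> 0" "\<forall>\<^sub>F \<tau> in F. c \<tau> \<noteq> 0" and "i \<noteq> j"
  shows "dominates b i c j \<or> dominates c j b i"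
  using dominates_linear_aux[of b c i j] dominates_linear_aux[of c b j i] assms
  by (cases i j rule: linorder_cases) auto

text \<open>The index is also the exponent, so any two candidates have different slopes and are
  comparable; in the induction the new index meets only the current winner.\<close>

lemma dominant_index_nonzero:
  assumes "finite J" "J \<noteq> {}" and "\<And>j. j \<in> J \<Longrightarrow> \<forall>\<^sub>F \<tau> in F. b j \<tau> \<noteq> 0"
  shows "\<exists>k\<in>J. \<forall>i\<in>J. i \<noteq> k \<longrightarrow> dominates (b k) k (b i) i"
  using assms
proof (induction J rule: finite_ne_induct)
  case (insert j J)
  then obtain k where k: "k \<in> J" "\<And>i. i \<in> J \<Longrightarrow> i \<noteq> k \<Longrightarrow> dominates (b k) k (b i) i"
    by auto
  with insert have "dominates (b k) k (b j) j \<or> dominates (b j) j (b k) k"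
    by (intro dominates_linear) auto
  thus ?case
  proof
    assume "dominates (b k) k (b j) j"
    with k show ?thesis by auto
  next
    assume "dominates (b j) j (b k) k"
    with k have "dominates (b j) j (b i) i" if "i \<in> J" for i
      using that dominates_trans by metis
    thus ?thesis by auto
  qed
qed auto

text \<open>The ultrafilter decides which coefficients vanish; these have infinite value and lose
  against any other. Finiteness of \<open>I\<close> allows the quantifier over indices to move
  inside both filters.\<close>

lemma dominant_index:
  assumes "finite I" and "\<forall>\<^sub>F \<tau> in F. \<exists>i\<in>I. b i \<tau> \<noteq> 0"
  obtains k where "k \<in> I" "\<forall>\<^sub>F \<tau> in F. b k \<tau> \<noteq> 0"
    "\<forall>\<^sub>F \<nu> in at_top. \<forall>\<^sub>F \<tau> in F. \<forall>i\<in>I. i \<noteq> k \<longrightarrow> v (b k \<tau> * t \<nu> ^ k) < v (b i \<tau> * t \<nu> ^ i)"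
proof -
  define J where "J = {i \<in> I. \<forall>\<^sub>F \<tau> in F. b i \<tau> \<noteq> 0}"
  have zero: "\<forall>\<^sub>F \<tau> in F. b i \<tau> = 0" if "i \<in> I - J" for i
    using that ultra_cases[of "\<lambda>\<tau>. b i \<tau> = 0"] by (auto simp: J_def)
  have "J \<noteq> {}"
  proof
    assume "J = {}"
    hence "\<forall>\<^sub>F \<tau> in F. \<forall>i\<in>I. b i \<tau> = 0"
      using zero assms(1) by (auto intro: eventually_ball_finite)
    with assms(2) have "\<forall>\<^sub>F \<tau> in F. False"
      by eventually_elim auto
    thus False by simp
  qed
  with assms(1) have "\<exists>k\<in>J. \<forall>i\<in>J. i \<noteq> k \<longrightarrow> dominates (b k) k (b i) i"
    by (intro dominant_index_nonzero) (auto simp: J_def)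
  then obtain k where k: "k \<in> J" "\<And>i. i \<in> J \<Longrightarrow> i \<noteq> k \<Longrightarrow> dominates (b k) k (b i) i"
    by blast
  have "dominates (b k) k (b i) i" if "i \<in> I - {k}" for i
    using that k zero[of i] by (cases "i \<in> J") (auto simp: J_def intro: dominates_zero)
  hence "\<forall>\<^sub>F \<nu> in at_top. \<forall>i\<in>I - {k}. \<forall>\<^sub>F \<tau> in F. v (b k \<tau> * t \<nu> ^ k) < v (b i \<tau> * t \<nu> ^ i)"
    unfolding dominates_def using assms(1) by (intro eventually_ball_finite) auto
  hence "\<forall>\<^sub>F \<nu> in at_top. \<forall>\<^sub>F \<tau> in F. \<forall>i\<in>I - {k}. v (b k \<tau> * t \<nu> ^ k) < v (b i \<tau> * t \<nu> ^ i)"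
    by eventually_elim (use assms(1) in \<open>simp add: eventually_ball_finite\<close>)
  hence "\<forall>\<^sub>F \<nu> in at_top. \<forall>\<^sub>F \<tau> in F. \<forall>i\<in>I. i \<noteq> k \<longrightarrow>
      v (b k \<tau> * t \<nu> ^ k) < v (b i \<tau> * t \<nu> ^ i)"
    by (auto elim!: eventually_mono)
  with k that show thesis
    by (auto simp: J_def)
qed

text \<open>The value is that of the dominant monomial. The polynomial may vary with \<tau> because
  the constant subtracted from a rational function will; the common degree bound keeps the set of
  indices finite.\<close>

lemma poly_dominant:
  assumes "\<And>\<tau>. degree (P \<tau>) \<le> n" and "\<And>\<tau>. P \<tau> \<noteq> 0"
  obtains k where "\<forall>\<^sub>F \<tau> in F. coeff (P \<tau>) k \<noteq> 0"
    "\<forall>\<^sub>F \<nu> in at_top. \<forall>\<^sub>F \<tau> in F. v (poly (P \<tau>) (s \<nu> - a \<tau>)) = v (coeff (P \<tau>) k * t \<nu> ^ k)"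
proof -
  have "\<exists>i\<in>{..n}. coeff (P \<tau>) i \<noteq> 0" for \<tau>
    using assms by (intro bexI[of _ "degree (P \<tau>)"]) auto
  then obtain k where k: "k \<in> {..n}" "\<forall>\<^sub>F \<tau> in F. coeff (P \<tau>) k \<noteq> 0"
    "\<forall>\<^sub>F \<nu> in at_top. \<forall>\<^sub>F \<tau> in F. \<forall>i\<in>{..n}. i \<noteq> k \<longrightarrow>
      v (coeff (P \<tau>) k * t \<nu> ^ k) < v (coeff (P \<tau>) i * t \<nu> ^ i)"
    using dominant_index[of "{..n}" "\<lambda>i \<tau>. coeff (P \<tau>) i"] by auto
  from k(3) eventually_t_nonzero eventually_ge_at_top[of N]
  have "\<forall>\<^sub>F \<nu> in at_top. \<forall>\<^sub>F \<tau> in F.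
      v (poly (P \<tau>) (s \<nu> - a \<tau>)) = v (coeff (P \<tau>) k * t \<nu> ^ k)"
  proof eventually_elim
    case (elim \<nu>)
    from elim(1) k(2) approx[OF elim(3)] show ?case
    proof eventually_elim
      case (elim \<tau>)
      have eq: "v (coeff (P \<tau>) i * (s \<nu> - a \<tau>) ^ i) = v (coeff (P \<tau>) i * t \<nu> ^ i)" for i
        by (intro v_mult_cong v_power_cong elim refl)
      have "v (t \<nu>) \<noteq> \<infinity>"
        using \<open>t \<nu> \<noteq> 0\<close> by simp
      hence "s \<nu> - a \<tau> \<noteq> 0"
        using elim(3) by (metis v_0)
      hence "v (\<Sum>i\<le>n. coeff (P \<tau>) i * (s \<nu> - a \<tau>) ^ i) = v (coeff (P \<tau>) k * (s \<nu> - a \<tau>) ^ k)"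
        using k(1) elim by (intro v_sum_eq_dominant) (auto simp: eq)
      thus ?case
        using assms(1) by (simp add: poly_eq_sum_le_degree[OF assms(1)] eq)
    qed
  qed
  with k(2) that show thesis by blast
qed

section \<open>Taylor expansion at the approximate pseudo-limits\<close>

abbreviation shift :: "'k poly \<Rightarrow> 'j \<Rightarrow> 'k poly" where
  "shift p \<tau> \<equiv> pcompose p [:a \<tau>, 1:]"

lemma poly_shift: "poly (shift p \<tau>) (x - a \<tau>) = poly p x"
  by (simp add: poly_pcompose)

lemma shift_dominant:
  assumes "\<And>\<tau>. degree (R \<tau>) \<le> n" and "\<And>\<tau>. R \<tau> \<noteq> 0"
  obtains k where "\<forall>\<^sub>F \<tau> in F. coeff (shift (R \<tau>) \<tau>) k \<noteq> 0"
    "\<forall>\<^sub>F \<nu> in at_top. \<forall>\<^sub>F \<tau> in F. v (poly (R \<tau>) (s \<nu>)) = v (coeff (shift (R \<tau>) \<tau>) k * t \<nu> ^ k)"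
proof (rule poly_dominant[of "\<lambda>\<tau>. shift (R \<tau>) \<tau>" n])
  show "degree (shift (R \<tau>) \<tau>) \<le> n" for \<tau>
    using assms(1)[of \<tau>] by (simp add: degree_pcompose)
  show "shift (R \<tau>) \<tau> \<noteq> 0" for \<tau>
    using assms(2)[of \<tau>] by (simp add: pcompose_eq_0_iff)
qed (use that in \<open>simp add: poly_shift\<close>)

text \<open>The value of the dominant monomial is finite. This keeps zeros of denominators, and with
  them the dummy values of \<open>eval_fract\<close>, away from a tail.\<close>

lemma eventually_poly_nonzero:
  assumes "p \<noteq> 0"
  shows "\<forall>\<^sub>F \<nu> in at_top. poly p (s \<nu>) \<noteq> 0"
proof -
  obtain k where k: "\<forall>\<^sub>F \<tau> in F. coeff (shift p \<tau>) k \<noteq> 0"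
    "\<forall>\<^sub>F \<nu> in at_top. \<forall>\<^sub>F \<tau> in F. v (poly p (s \<nu>)) = v (coeff (shift p \<tau>) k * t \<nu> ^ k)"
    by (rule shift_dominant[of "\<lambda>_. p" "degree p"]) (use assms in auto)
  from k(2) eventually_t_nonzero show ?thesis
  proof eventually_elim
    case (elim \<nu>)
    have "\<forall>\<^sub>F \<tau> in F. poly p (s \<nu>) \<noteq> 0"
      using elim(1) k(1)
    proof eventually_elim
      case (elim \<tau>)
      hence "v (poly p (s \<nu>)) \<noteq> \<infinity>"
        using \<open>t \<nu> \<noteq> 0\<close> by simp
      thus ?case by simp
    qed
    \<comment> \<open>The claim does not mention \<tau>, so properness of \<open>F\<close> removes
      the inner quantifier.\<close>
    thus ?case by simp
  qed
qed

text \<open>If numerator and denominator have the same dominant index, subtracting the quotient of the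
  dominant coefficients removes that index from the numerator; so the remaining exponent \<open>m\<close> is
  never zero.\<close>

lemma rational_expansion:
  assumes "p \<noteq> 0" "q \<noteq> 0" and "\<And>c. p \<noteq> smult c q"
  obtains c C m where "m \<noteq> 0" "\<forall>\<^sub>F \<nu> in at_top. \<forall>\<^sub>F \<tau> in F. C \<tau> \<noteq> 0 \<and>
    v (poly p (s \<nu>) / poly q (s \<nu>) - c \<tau>) = v (C \<tau> * t \<nu> powi m)"
proof -
  obtain l where l: "\<forall>\<^sub>F \<tau> in F. coeff (shift q \<tau>) l \<noteq> 0"
    "\<forall>\<^sub>F \<nu> in at_top. \<forall>\<^sub>F \<tau> in F. v (poly q (s \<nu>)) = v (coeff (shift q \<tau>) l * t \<nu> ^ l)"
    by (rule shift_dominant[of "\<lambda>_. q" "degree q"]) (use assms in auto)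
  obtain k where k: "\<forall>\<^sub>F \<tau> in F. coeff (shift p \<tau>) k \<noteq> 0"
    "\<forall>\<^sub>F \<nu> in at_top. \<forall>\<^sub>F \<tau> in F. v (poly p (s \<nu>)) = v (coeff (shift p \<tau>) k * t \<nu> ^ k)"
    by (rule shift_dominant[of "\<lambda>_. p" "degree p"]) (use assms in auto)
  have "\<exists>c i. i \<noteq> l \<and> (\<forall>\<^sub>F \<tau> in F. coeff (shift (p - smult (c \<tau>) q) \<tau>) i \<noteq> 0) \<and>
    (\<forall>\<^sub>F \<nu> in at_top. \<forall>\<^sub>F \<tau> in F. v (poly (p - smult (c \<tau>) q) (s \<nu>)) =
      v (coeff (shift (p - smult (c \<tau>) q) \<tau>) i * t \<nu> ^ i))"
  proof (cases "k = l")
    case False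
    thus ?thesis
      using k by (intro exI[of _ "\<lambda>_. 0"] exI[of _ k]) simp
  next
    case True
    define c where "c \<tau> = coeff (shift p \<tau>) l / coeff (shift q \<tau>) l" for \<tau>
    obtain i where i: "\<forall>\<^sub>F \<tau> in F. coeff (shift (p - smult (c \<tau>) q) \<tau>) i \<noteq> 0"
      "\<forall>\<^sub>F \<nu> in at_top. \<forall>\<^sub>F \<tau> in F. v (poly (p - smult (c \<tau>) q) (s \<nu>)) =
        v (coeff (shift (p - smult (c \<tau>) q) \<tau>) i * t \<nu> ^ i)"
    proof (rule shift_dominant[of "\<lambda>\<tau>. p - smult (c \<tau>) q" "max (degree p) (degree q)"])
      show "degree (p - smult (c \<tau>) q) \<le> max (degree p) (degree q)" for \<tau>
        by (intro degree_diff_le) auto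
    qed (use assms in auto)
    from i(1) l(1) have "\<forall>\<^sub>F \<tau> in F. i \<noteq> l"
      by eventually_elim (auto simp: c_def pcompose_diff pcompose_smult)
    with i show ?thesis by auto
  qed
  then obtain c i where i: "i \<noteq> l" "\<forall>\<^sub>F \<tau> in F. coeff (shift (p - smult (c \<tau>) q) \<tau>) i \<noteq> 0"
    "\<forall>\<^sub>F \<nu> in at_top. \<forall>\<^sub>F \<tau> in F. v (poly (p - smult (c \<tau>) q) (s \<nu>)) =
      v (coeff (shift (p - smult (c \<tau>) q) \<tau>) i * t \<nu> ^ i)"
    by blast
  define C where "C \<tau> = coeff (shift (p - smult (c \<tau>) q) \<tau>) i / coeff (shift q \<tau>) l" for \<tau>
  show thesis
  proof (rule that)
    show "int i - int l \<noteq> 0"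
      using i(1) by simp
    show "\<forall>\<^sub>F \<nu> in at_top. \<forall>\<^sub>F \<tau> in F. C \<tau> \<noteq> 0 \<and>
      v (poly p (s \<nu>) / poly q (s \<nu>) - c \<tau>) = v (C \<tau> * t \<nu> powi (int i - int l))"
      using i(3) l(2) eventually_t_nonzero eventually_poly_nonzero[OF assms(2)]
    proof eventually_elim
      case (elim \<nu>)
      from elim(1,2) i(2) l(1) show ?case
      proof eventually_elim
        case (elim \<tau>)
        have "poly p (s \<nu>) / poly q (s \<nu>) - c \<tau> = poly (p - smult (c \<tau>) q) (s \<nu>) / poly q (s \<nu>)"
          using \<open>poly q (s \<nu>) \<noteq> 0\<close> by (simp add: field_simps)
        also have "v \<dots> = v (coeff (shift (p - smult (c \<tau>) q) \<tau>) i * t \<nu> ^ i /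
            (coeff (shift q \<tau>) l * t \<nu> ^ l))"
          by (intro v_divide_cong elim)
        also have "\<dots> = v (C \<tau> * t \<nu> powi (int i - int l))"
          using \<open>t \<nu> \<noteq> 0\<close> by (simp add: C_def power_int_diff)
        finally show ?case
          using elim by (simp add: C_def)
      qed
    qed
  qed
qed

text \<open>By \<open>rational_expansion\<close> the values relative to \<open>c \<tau>\<close>
  follow a nonzero power of \<open>t\<close>, whose exponent keeps or reverses the direction of
  \<open>t\<close>.\<close>

lemma rational_eventually_strictly_pseudo_monotone:
  assumes "p \<noteq> 0" "q \<noteq> 0" and "\<And>c. p \<noteq> smult c q"
    and r: "\<forall>\<^sub>F \<nu> in at_top. r \<nu> = poly p (s \<nu>) / poly q (s \<nu>)"
  shows "eventually_strictly_pseudo_monotone v r"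
proof -
  obtain c C m where m: "m \<noteq> 0" "\<forall>\<^sub>F \<nu> in at_top. \<forall>\<^sub>F \<tau> in F. C \<tau> \<noteq> 0 \<and>
    v (poly p (s \<nu>) / poly q (s \<nu>) - c \<tau>) = v (C \<tau> * t \<nu> powi m)"
    using rational_expansion[OF assms(1-3)] by blast
  from m(2) r eventually_ge_at_top[of N]
  have "\<forall>\<^sub>F \<nu> in at_top. N \<le> \<nu> \<and> (\<forall>\<^sub>F \<tau> in F. C \<tau> \<noteq> 0 \<and> v (r \<nu> - c \<tau>) = v (C \<tau> * t \<nu> powi m))"
    by eventually_elim simp
  then obtain M where M: "\<And>\<nu>. M \<le> \<nu> \<Longrightarrow> N \<le> \<nu>"
    "\<And>\<nu>. M \<le> \<nu> \<Longrightarrow> \<forall>\<^sub>F \<tau> in F. C \<tau> \<noteq> 0 \<and> v (r \<nu> - c \<tau>) = v (C \<tau> * t \<nu> powi m)"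
    unfolding eventually_at_top_linorder by blast
  \<comment> \<open>Three sets of the ultrafilter have a common element, so any three indices share
    a centre \<open>c \<tau>\<close>, although no single \<tau> need serve a whole tail.\<close>
  have common: "\<exists>\<tau>. C \<tau> \<noteq> 0 \<and> (\<forall>x\<in>{\<nu>, \<rho>, \<sigma>}. v (r x - c \<tau>) = v (C \<tau> * t x powi m))"
    if "M \<le> \<nu>" "\<nu> < \<rho>" "\<rho> < \<sigma>" for \<nu> \<rho> \<sigma>
  proof -
    have "\<forall>\<^sub>F \<tau> in F. C \<tau> \<noteq> 0 \<and> (\<forall>x\<in>{\<nu>, \<rho>, \<sigma>}. v (r x - c \<tau>) = v (C \<tau> * t x powi m))"
      using M(2)[of \<nu>] M(2)[of \<rho>] M(2)[of \<sigma>] that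
      by (simp add: eventually_conj_iff)
    thus ?thesis
      using F_not_bot eventually_happens' by blast
  qed
  have "increasing_from N (\<lambda>\<nu>. t \<nu> powi m) \<or> decreasing_from N (\<lambda>\<nu>. t \<nu> powi m)"
    using t_monotone \<open>m \<noteq> 0\<close> t_nonzero increasing_from_powi[of N t m] decreasing_from_powi[of N t m]
      increasing_from_powi_neg[of N t m] decreasing_from_powi_neg[of N t m]
    by (cases "m > 0") auto
  hence "strictly_pseudo_monotone_on v {M..} r"
  proof
    assume inc: "increasing_from N (\<lambda>\<nu>. t \<nu> powi m)"
    have "pseudo_convergent_on v {M..} r"
    proof (rule pseudo_convergent_onI)
      fix \<nu> \<rho> \<sigma> assume *: "M \<le> \<nu>" "\<nu> < \<rho>" "\<rho> < \<sigma>"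
      obtain \<tau> where "C \<tau> \<noteq> 0" "\<forall>x\<in>{\<nu>, \<rho>, \<sigma>}. v (r x - c \<tau>) = v (C \<tau> * t x powi m)"
        using common[OF *] by blast
      thus "\<exists>c. v (r \<nu> - c) < v (r \<rho> - c) \<and> v (r \<rho> - c) < v (r \<sigma> - c)"
        using increasing_fromD[OF inc, of \<nu> \<rho>] increasing_fromD[OF inc, of \<rho> \<sigma>] *
          M(1)[of \<nu>] M(1)[OF order_trans[of M \<nu> \<rho>]]
        by (intro exI[of _ "c \<tau>"]) (simp add: v_mult_less_cancel)
    qed
    thus ?thesis by (simp add: strictly_pseudo_monotone_on_def)
  next
    assume dec: "decreasing_from N (\<lambda>\<nu>. t \<nu> powi m)"
    have "pseudo_divergent_on v {M..} r"
    proof (rule pseudo_divergent_onI)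
      fix \<nu> \<rho> \<sigma> assume *: "M \<le> \<nu>" "\<nu> < \<rho>" "\<rho> < \<sigma>"
      obtain \<tau> where "C \<tau> \<noteq> 0" "\<forall>x\<in>{\<nu>, \<rho>, \<sigma>}. v (r x - c \<tau>) = v (C \<tau> * t x powi m)"
        using common[OF *] by blast
      thus "\<exists>c. v (r \<rho> - c) < v (r \<nu> - c) \<and> v (r \<sigma> - c) < v (r \<rho> - c)"
        using decreasing_fromD[OF dec, of \<nu> \<rho>] decreasing_fromD[OF dec, of \<rho> \<sigma>] *
          M(1)[of \<nu>] M(1)[OF order_trans[of M \<nu> \<rho>]]
        by (intro exI[of _ "c \<tau>"]) (simp add: v_mult_less_cancel)
    qed
    thus ?thesis by (simp add: strictly_pseudo_monotone_on_def)
  qed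
  thus ?thesis
    by (auto simp: eventually_strictly_pseudo_monotone_def)
qed

end

section \<open>Gauge and breadth ideal\<close>

context valued_field
begin

text \<open>Without a maximal index any two tails share three increasing indices, on which the two
  inequalities contradict each other.\<close>

lemma pseudo_convergent_not_divergent:
  fixes r :: "'i::{wellorder,no_top} \<Rightarrow> 'f"
  assumes "pseudo_convergent_on v {M..} r" "pseudo_divergent_on v {M'..} r"
  shows False
proof -
  obtain \<rho> where "max M M' < \<rho>" using gt_ex by blast
  moreover obtain \<sigma> where "\<rho> < \<sigma>" using gt_ex by blast
  ultimately have "max M M' \<in> {M..} \<inter> {M'..}" "\<rho> \<in> {M..} \<inter> {M'..}" "\<sigma> \<in> {M..} \<inter> {M'..}"
    by auto
  with \<open>max M M' < \<rho>\<close> \<open>\<rho> < \<sigma>\<close> show False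
    using assms unfolding pseudo_convergent_on_def pseudo_divergent_on_def
    by (meson IntD1 IntD2 order_less_asym)
qed

lemma strictly_pseudo_monotone_on_tail_start:
  fixes r :: "'i::{wellorder,no_top} \<Rightarrow> 'f"
  assumes "strictly_pseudo_monotone_on v {M..} r"
  shows "strictly_pseudo_monotone_on v {tail_start v r..} r" "tail_start v r \<le> M"
  unfolding tail_start_def using assms by (rule LeastI, rule Least_le)

text \<open>The longest strictly pseudo-monotone tail could a priori be of the other kind; its
  overlap with the given tail excludes this.\<close>

lemma pseudo_convergent_on_tail_start:
  fixes r :: "'i::{wellorder,no_top} \<Rightarrow> 'f"
  assumes "pseudo_convergent_on v {M..} r"
  shows "pseudo_convergent_on v {tail_start v r..} r"
  using assms strictly_pseudo_monotone_on_tail_start[of M r] pseudo_convergent_not_divergent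
  unfolding strictly_pseudo_monotone_on_def by blast

lemma pseudo_divergent_on_tail_start:
  fixes r :: "'i::{wellorder,no_top} \<Rightarrow> 'f"
  assumes "pseudo_divergent_on v {M..} r"
  shows "pseudo_divergent_on v {tail_start v r..} r"
  using assms strictly_pseudo_monotone_on_tail_start[of M r] pseudo_convergent_not_divergent
  unfolding strictly_pseudo_monotone_on_def by blast

text \<open>Two later terms differ by an element of larger value, so exchanging them does not affect
  the distance to \<open>r \<nu>\<close>. Hence the gauge is well defined.\<close>

lemma pseudo_convergent_on_diff:
  assumes "pseudo_convergent_on v {M..} r" "M \<le> \<nu>" "\<nu> < \<rho>" "\<nu> < \<sigma>"
  shows "v (r \<rho> - r \<nu>) = v (r \<sigma> - r \<nu>)"
proof -
  have *: "v (r \<sigma>' - r \<nu>) = v (r \<rho>' - r \<nu>)" if "\<nu> < \<rho>'" "\<rho>' < \<sigma>'" for \<rho>' \<sigma>'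
  proof -
    have "v (r \<rho>' - r \<nu>) < v (r \<sigma>' - r \<rho>')"
      using assms(1,2) that by (force simp: pseudo_convergent_on_def)
    from v_add_eq[OF this] show ?thesis by simp
  qed
  show ?thesis
  proof (cases \<rho> \<sigma> rule: linorder_cases)
    case less
    thus ?thesis using *[of \<rho> \<sigma>] assms by simp
  next
    case greater
    thus ?thesis using *[of \<sigma> \<rho>] assms by simp
  qed simp
qed

text \<open>Now it is the earlier terms whose difference has the larger value.\<close>

lemma pseudo_divergent_on_diff:
  assumes "pseudo_divergent_on v {M..} r" "M \<le> \<rho>" "M \<le> \<sigma>" "\<rho> < \<nu>" "\<sigma> < \<nu>"
  shows "v (r \<rho> - r \<nu>) = v (r \<sigma> - r \<nu>)"
proof -
  have *: "v (r \<rho>' - r \<nu>) = v (r \<sigma>' - r \<nu>)" if "M \<le> \<rho>'" "\<rho>' < \<sigma>'" "\<sigma>' < \<nu>" for \<rho>' \<sigma>'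
  proof -
    have "v (r \<nu> - r \<sigma>') < v (r \<sigma>' - r \<rho>')"
      using assms(1) that by (force simp: pseudo_divergent_on_def)
    from v_add_eq[OF this] show ?thesis
      by (simp add: v_diff_commute)
  qed
  show ?thesis
  proof (cases \<rho> \<sigma> rule: linorder_cases)
    case less
    thus ?thesis using *[of \<rho> \<sigma>] assms by simp
  next
    case greater
    thus ?thesis using *[of \<sigma> \<rho>] assms by simp
  qed simp
qed

lemma gauge_convergent:
  fixes r :: "'i::{wellorder,no_top} \<Rightarrow> 'f"
  assumes "pseudo_convergent_on v {M..} r" "tail_start v r \<le> \<nu>" "\<nu> < \<rho>"
  shows "gauge v r \<nu> = v (r \<rho> - r \<nu>)"
proof -
  have pc: "pseudo_convergent_on v {tail_start v r..} r"
    using assms(1) by (rule pseudo_convergent_on_tail_start)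
  have "(THE \<delta>. \<forall>\<rho>. \<nu> < \<rho> \<longrightarrow> v (r \<rho> - r \<nu>) = \<delta>) = v (r \<rho> - r \<nu>)"
  proof (rule the_equality)
    show "\<forall>\<sigma>. \<nu> < \<sigma> \<longrightarrow> v (r \<sigma> - r \<nu>) = v (r \<rho> - r \<nu>)"
      using pseudo_convergent_on_diff[OF pc] assms by blast
  qed (use assms in auto)
  with pc show ?thesis
    by (simp add: gauge_def Let_def)
qed

lemma gauge_divergent:
  fixes r :: "'i::{wellorder,no_top} \<Rightarrow> 'f"
  assumes "pseudo_divergent_on v {M..} r" "tail_start v r \<le> \<rho>" "\<rho> < \<nu>"
  shows "gauge v r \<nu> = v (r \<rho> - r \<nu>)"
proof -
  have pd: "pseudo_divergent_on v {tail_start v r..} r"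
    using assms(1) by (rule pseudo_divergent_on_tail_start)
  have "(THE \<delta>. \<forall>\<rho>. tail_start v r \<le> \<rho> \<and> \<rho> < \<nu> \<longrightarrow> v (r \<rho> - r \<nu>) = \<delta>) = v (r \<rho> - r \<nu>)"
  proof (rule the_equality)
    show "\<forall>\<sigma>. tail_start v r \<le> \<sigma> \<and> \<sigma> < \<nu> \<longrightarrow> v (r \<sigma> - r \<nu>) = v (r \<rho> - r \<nu>)"
      using pseudo_divergent_on_diff[OF pd] assms by blast
  qed (use assms in auto)
  moreover have "\<not> pseudo_convergent_on v {tail_start v r..} r"
    using pd pseudo_convergent_not_divergent by blast
  ultimately show ?thesis
    by (simp add: gauge_def Let_def)
qed

lemma gauge_convergent_less:
  fixes r :: "'i::{wellorder,no_top} \<Rightarrow> 'f"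
  assumes "pseudo_convergent_on v {M..} r" "tail_start v r \<le> \<nu>" "\<nu> < \<rho>"
  shows "gauge v r \<nu> < gauge v r \<rho>"
proof -
  obtain \<sigma> where "\<rho> < \<sigma>" using gt_ex by blast
  moreover have "pseudo_convergent_on v {tail_start v r..} r"
    using assms(1) by (rule pseudo_convergent_on_tail_start)
  hence "v (r \<rho> - r \<nu>) < v (r \<sigma> - r \<rho>)"
    using \<open>\<rho> < \<sigma>\<close> assms by (force simp: pseudo_convergent_on_def)
  ultimately show ?thesis
    using gauge_convergent[OF assms(1), of \<nu> \<rho>] gauge_convergent[OF assms(1), of \<rho> \<sigma>] assms
    by simp
qed

lemma gauge_divergent_less:
  fixes r :: "'i::{wellorder,no_top} \<Rightarrow> 'f"
  assumes "pseudo_divergent_on v {M..} r" "tail_start v r < \<nu>" "\<nu> < \<rho>"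
  shows "gauge v r \<rho> < gauge v r \<nu>"
proof -
  let ?N = "tail_start v r"
  have "pseudo_divergent_on v {?N..} r"
    using assms(1) by (rule pseudo_divergent_on_tail_start)
  \<comment> \<open>The gauge at \<nu> is measured from an earlier index, here the start of the
    tail; therefore \<nu> lies strictly beyond it.\<close>
  hence "v (r \<rho> - r \<nu>) < v (r \<nu> - r ?N)"
    using assms by (force simp: pseudo_divergent_on_def)
  thus ?thesis
    using gauge_divergent[OF assms(1), of \<nu> \<rho>] gauge_divergent[OF assms(1), of ?N \<nu>] assms
    by (simp add: v_diff_commute)
qed

lemma breadth_ideal_convergent:
  fixes r :: "'i::{wellorder,no_top} \<Rightarrow> 'f"
  assumes "pseudo_convergent_on v {M..} r"
  shows "breadth_ideal v r = {x. \<forall>\<nu>\<ge>tail_start v r. gauge v r \<nu> < v x}"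
  using pseudo_convergent_on_tail_start[OF assms] by (simp add: breadth_ideal_def Let_def)

lemma breadth_ideal_divergent:
  fixes r :: "'i::{wellorder,no_top} \<Rightarrow> 'f"
  assumes "pseudo_divergent_on v {M..} r"
  shows "breadth_ideal v r = {x. \<exists>\<nu>>tail_start v r. gauge v r \<nu> < v x}"
proof -
  have "\<not> pseudo_convergent_on v {tail_start v r..} r"
    using assms pseudo_divergent_on_tail_start pseudo_convergent_not_divergent by blast
  thus ?thesis by (simp add: breadth_ideal_def Let_def)
qed

lemma mem_pseudo_limits_iff:
  fixes r :: "'i::{wellorder,no_top} \<Rightarrow> 'f"
  shows "x \<in> pseudo_limits v r \<longleftrightarrow> (\<forall>\<^sub>F \<nu> in at_top. v (x - r \<nu>) = gauge v r \<nu>)"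
  by (simp add: pseudo_limits_def pseudo_limit_def extended.map_id)

section \<open>Pseudo-limits of sequences with monotone values\<close>

lemma v_ge_if_v_diff_ge: "c \<le> v (x - y) \<Longrightarrow> c \<le> v y \<Longrightarrow> c \<le> v x"
  using v_add_ge[of "x - y" y] by (auto simp: min_def split: if_splits)

lemma increasing_from_imp_pseudo_convergent:
  assumes "increasing_from M r"
  shows "pseudo_convergent_on v {M..} r"
  by (rule pseudo_convergent_onI, rule exI[of _ 0]) (auto intro!: increasing_fromD[OF assms])

lemma decreasing_from_imp_pseudo_divergent:
  assumes "decreasing_from M r"
  shows "pseudo_divergent_on v {M..} r"
  by (rule pseudo_divergent_onI, rule exI[of _ 0]) (auto intro!: decreasing_fromD[OF assms])

text \<open>Increasing values make \<open>v (r \<nu>)\<close> the gauge from \<open>M\<close> on,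
  that is, 0 is a pseudo-limit; the pseudo-limits form the coset of the breadth ideal through
  0.\<close>

lemma increasing_from_pseudo_limits:
  fixes r :: "'i::{wellorder,no_top} \<Rightarrow> 'f"
  assumes "increasing_from M r"
  shows "pseudo_limits v r = breadth_ideal v r"
proof -
  have pc: "pseudo_convergent_on v {M..} r"
    using assms by (rule increasing_from_imp_pseudo_convergent)
  have ts: "tail_start v r \<le> M"
    using pc by (intro strictly_pseudo_monotone_on_tail_start) (simp add: strictly_pseudo_monotone_on_def)
  have gauge_eq: "gauge v r \<nu> = v (r \<nu>)" if "M \<le> \<nu>" for \<nu>
  proof -
    obtain \<rho> where "\<nu> < \<rho>" using gt_ex by blast
    moreover from this have "v (r \<nu>) < v (r \<rho>)"
      using assms that by (rule increasing_fromD[rotated 2])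
    ultimately show ?thesis
      using gauge_convergent[OF pc, of \<nu> \<rho>] that ts v_diff_eq by simp
  qed
  show ?thesis
    unfolding breadth_ideal_convergent[OF pc] set_eq_iff mem_pseudo_limits_iff mem_Collect_eq
  proof (rule allI, rule iffI)
    fix x assume "\<forall>\<^sub>F \<nu> in at_top. v (x - r \<nu>) = gauge v r \<nu>"
    then obtain L where L: "\<And>\<nu>. L \<le> \<nu> \<Longrightarrow> v (x - r \<nu>) = gauge v r \<nu>"
      by (auto simp: eventually_at_top_linorder)
    show "\<forall>\<nu>\<ge>tail_start v r. gauge v r \<nu> < v x"
    proof (intro allI impI)
      fix \<nu> assume \<nu>: "tail_start v r \<le> \<nu>"
      obtain \<rho> where \<rho>: "max \<nu> (max L M) < \<rho>" using gt_ex by blast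
      have "gauge v r \<rho> \<le> v x"
        using L[of \<rho>] gauge_eq[of \<rho>] \<rho> by (intro v_ge_if_v_diff_ge[of _ x "r \<rho>"]) auto
      moreover have "gauge v r \<nu> < gauge v r \<rho>"
        using gauge_convergent_less[OF pc \<nu>] \<rho> by simp
      ultimately show "gauge v r \<nu> < v x" by simp
    qed
  next
    fix x assume x: "\<forall>\<nu>\<ge>tail_start v r. gauge v r \<nu> < v x"
    show "\<forall>\<^sub>F \<nu> in at_top. v (x - r \<nu>) = gauge v r \<nu>"
      using eventually_ge_at_top[of M]
    proof eventually_elim
      case (elim \<nu>)
      hence "v (r \<nu>) < v x" using x gauge_eq ts by (metis order_trans)
      thus ?case using gauge_eq elim v_diff_eq by simp
    qed
  qed
qed

lemma decreasing_from_pseudo_limits: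
  fixes r :: "'i::{wellorder,no_top} \<Rightarrow> 'f"
  assumes "decreasing_from M r"
  shows "pseudo_limits v r = breadth_ideal v r"
proof -
  have pd: "pseudo_divergent_on v {M..} r"
    using assms by (rule decreasing_from_imp_pseudo_divergent)
  have ts: "tail_start v r \<le> M"
    using pd by (intro strictly_pseudo_monotone_on_tail_start) (simp add: strictly_pseudo_monotone_on_def)
  \<comment> \<open>The bound on \<nu> is strict because the gauge is computed from the earlier term
    \<open>r M\<close>.\<close>
  have gauge_eq: "gauge v r \<nu> = v (r \<nu>)" if "M < \<nu>" for \<nu>
  proof -
    have "v (r \<nu>) < v (r M)"
      using assms that by (simp add: decreasing_fromD)
    thus ?thesis
      using gauge_divergent[OF pd ts that] v_diff_eq by simp
  qed
  show ?thesis
    unfolding breadth_ideal_divergent[OF pd] set_eq_iff mem_pseudo_limits_iff mem_Collect_eq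
  proof (rule allI, rule iffI)
    fix x assume "\<forall>\<^sub>F \<nu> in at_top. v (x - r \<nu>) = gauge v r \<nu>"
    then obtain L where L: "\<And>\<nu>. L \<le> \<nu> \<Longrightarrow> v (x - r \<nu>) = gauge v r \<nu>"
      by (auto simp: eventually_at_top_linorder)
    obtain \<rho> where \<rho>: "max L M < \<rho>" using gt_ex by blast
    \<comment> \<open>At \<rho> only a weak inequality for \<open>v x\<close> is available; the
      smaller gauge at \<sigma> makes it strict.\<close>
    obtain \<sigma> where \<sigma>: "\<rho> < \<sigma>" using gt_ex by blast
    have "gauge v r \<rho> \<le> v x"
      using L[of \<rho>] gauge_eq[of \<rho>] \<rho> by (intro v_ge_if_v_diff_ge[of _ x "r \<rho>"]) auto
    moreover have "gauge v r \<sigma> < gauge v r \<rho>"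
      using gauge_divergent_less[OF pd _ \<sigma>] \<rho> ts by auto
    ultimately have "tail_start v r < \<sigma>" "gauge v r \<sigma> < v x"
      using ts \<rho> \<sigma> by auto
    thus "\<exists>\<nu>>tail_start v r. gauge v r \<nu> < v x" by blast
  next
    fix x assume "\<exists>\<nu>>tail_start v r. gauge v r \<nu> < v x"
    then obtain \<nu> where \<nu>: "tail_start v r < \<nu>" "gauge v r \<nu> < v x" by blast
    show "\<forall>\<^sub>F \<rho> in at_top. v (x - r \<rho>) = gauge v r \<rho>"
      using eventually_gt_at_top[of "max \<nu> M"]
    proof eventually_elim
      case (elim \<rho>)
      have "gauge v r \<rho> < v x"
        using gauge_divergent_less[OF pd \<nu>(1), of \<rho>] \<nu> elim by simp
      thus ?case using gauge_eq[of \<rho>] elim v_diff_eq[of "r \<rho>" x] by simp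
    qed
  qed
qed

end

section \<open>Scaled sequences\<close>

text \<open>The scale \<open>t\<close> represents the gauge by field elements and treats both kinds
  at once: a distance belongs to the earlier index in the first alternative and to the later one in
  the second.\<close>

locale scaled_sequence = valued_field v
  for v :: "'f::field \<Rightarrow> 'g::linordered_ab_group_add extended" +
  fixes s t :: "'i::{wellorder,no_top} \<Rightarrow> 'f" and N :: 'i
  assumes t_nonzero: "\<And>\<nu>. N \<le> \<nu> \<Longrightarrow> t \<nu> \<noteq> 0"
    and kind: "increasing_from N t \<and> (\<forall>\<nu>\<ge>N. \<forall>\<rho>>\<nu>. v (s \<rho> - s \<nu>) = v (t \<nu>)) \<or>
      decreasing_from N t \<and> (\<forall>\<nu>\<ge>N. \<forall>\<rho>>\<nu>. v (s \<rho> - s \<nu>) = v (t \<rho>))"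
begin

text \<open>A pseudo-convergent sequence need not have a pseudo-limit in the field; along an ultrafilter
  its own terms play that role, as a pseudo-limit in the ultrapower would.\<close>

lemma pseudo_approximation_exists:
  "\<exists>(a :: 'i \<Rightarrow> 'f) F N'. pseudo_approximation v s t a F N'"
proof -
  obtain F :: "'i filter" where F: "F \<le> at_top" "ultrafilter F"
    by (rule ultrafilter_le_exists[of at_top]) auto
  from kind show ?thesis
  proof
    assume inc: "increasing_from N t \<and> (\<forall>\<nu>\<ge>N. \<forall>\<rho>>\<nu>. v (s \<rho> - s \<nu>) = v (t \<nu>))"
    have "\<forall>\<^sub>F \<tau> in F. v (s \<nu> - s \<tau>) = v (t \<nu>)" if "N \<le> \<nu>" for \<nu>
    proof (rule filter_leD[OF F(1)])
      show "\<forall>\<^sub>F \<tau> in at_top. v (s \<nu> - s \<tau>) = v (t \<nu>)"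
        using eventually_gt_at_top[of \<nu>]
        by eventually_elim (use inc that v_diff_commute in metis)
    qed
    hence "pseudo_approximation v s t s F N"
      using F inc t_nonzero by unfold_locales auto
    thus ?thesis by blast
  next
    assume dec: "decreasing_from N t \<and> (\<forall>\<nu>\<ge>N. \<forall>\<rho>>\<nu>. v (s \<rho> - s \<nu>) = v (t \<rho>))"
    \<comment> \<open>In the pseudo-divergent case the term \<open>s N\<close> is itself a
      pseudo-limit, with the right distances only at indices beyond \<open>N\<close>.\<close>
    obtain N' where "N < N'" using gt_ex by blast
    hence "pseudo_approximation v s t (\<lambda>_. s N) F N'"
      using F dec t_nonzero by unfold_locales (auto simp: decreasing_from_def)
    thus ?thesis by blast
  qed
qed

text \<open>This makes roots that are not pseudo-limits contribute only a constant to the value of a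
  polynomial.\<close>

lemma pseudo_limit_or_constant:
  assumes "\<not> (\<forall>\<^sub>F \<nu> in at_top. v (z - s \<nu>) = v (t \<nu>))"
  shows "\<exists>C. C \<noteq> 0 \<and> (\<forall>\<^sub>F \<nu> in at_top. v (z - s \<nu>) = v C)"
  using kind
proof
  assume inc: "increasing_from N t \<and> (\<forall>\<nu>\<ge>N. \<forall>\<rho>>\<nu>. v (s \<rho> - s \<nu>) = v (t \<nu>))"
  \<comment> \<open>One mismatch determines all later distances: their value is the smaller of
    \<open>v (z - s \<nu>)\<close> and \<open>v (t \<nu>)\<close>.\<close>
  obtain \<nu> where \<nu>: "N \<le> \<nu>" "v (z - s \<nu>) \<noteq> v (t \<nu>)"
    using assms by (auto simp: eventually_at_top_linorder)
  have split: "z - s \<rho> = (z - s \<nu>) - (s \<rho> - s \<nu>)" for \<rho>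
    by simp
  have diff: "\<forall>\<^sub>F \<rho> in at_top. v (s \<rho> - s \<nu>) = v (t \<nu>)"
    using eventually_gt_at_top[of \<nu>] by eventually_elim (use inc \<nu> in blast)
  show ?thesis
  proof (cases "v (z - s \<nu>) < v (t \<nu>)")
    case True
    from diff have "\<forall>\<^sub>F \<rho> in at_top. v (z - s \<rho>) = v (z - s \<nu>)"
    proof eventually_elim
      case (elim \<rho>)
      thus ?case
        unfolding split[of \<rho>] using True by (intro v_diff_eq) simp
    qed
    thus ?thesis
      using nonzero_if_v_less[OF True] by blast
  next
    case False
    with \<nu>(2) have gt: "v (t \<nu>) < v (z - s \<nu>)" by simp
    from diff have "\<forall>\<^sub>F \<rho> in at_top. v (z - s \<rho>) = v (t \<nu>)"
    proof eventually_elim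
      case (elim \<rho>)
      with gt have "v (s \<rho> - s \<nu>) < v (z - s \<nu>)" by simp
      from v_diff_eq(2)[OF this] show ?case
        using elim by simp
    qed
    thus ?thesis
      using t_nonzero[OF \<nu>(1)] by blast
  qed
next
  assume dec: "decreasing_from N t \<and> (\<forall>\<nu>\<ge>N. \<forall>\<rho>>\<nu>. v (s \<rho> - s \<nu>) = v (t \<rho>))"
  \<comment> \<open>Otherwise the decreasing values of \<open>t\<close> eventually lie below
    \<open>v (z - s N)\<close>, and the distances from \<open>z\<close> would follow
    \<open>t\<close> after all.\<close>
  have less: "v (z - s N) < v (t \<sigma>)" if "N < \<sigma>" for \<sigma>
  proof (rule ccontr)
    assume "\<not> v (z - s N) < v (t \<sigma>)"
    hence ge: "v (t \<sigma>) \<le> v (z - s N)" by simp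
    have "\<forall>\<^sub>F \<rho> in at_top. v (z - s \<rho>) = v (t \<rho>)"
      using eventually_gt_at_top[of \<sigma>]
    proof eventually_elim
      case (elim \<rho>)
      have "v (s \<rho> - s N) = v (t \<rho>)"
        using dec that elim by auto
      moreover have "v (t \<rho>) < v (t \<sigma>)"
        using dec that elim decreasing_fromD[of N t \<sigma> \<rho>] by simp
      ultimately have "v ((z - s N) - (s \<rho> - s N)) = v (t \<rho>)"
        using ge v_diff_eq(2)[of "s \<rho> - s N" "z - s N"] by simp
      thus ?case by simp
    qed
    with assms show False by contradiction
  qed
  show ?thesis
  proof (intro exI conjI)
    obtain \<sigma> where "N < \<sigma>" using gt_ex by blast
    thus "z - s N \<noteq> 0"
      using less nonzero_if_v_less by blast
    show "\<forall>\<^sub>F \<rho> in at_top. v (z - s \<rho>) = v (z - s N)"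
      using eventually_gt_at_top[of N]
    proof eventually_elim
      case (elim \<rho>)
      hence eq: "v (s \<rho> - s N) = v (t \<rho>)" using dec by blast
      hence "v ((z - s N) - (s \<rho> - s N)) = v (z - s N)"
        using less[OF elim] v_diff_eq(1)[of "z - s N" "s \<rho> - s N"] by simp
      thus ?case by simp
    qed
  qed
qed

end

section \<open>Field elements realising the gauge\<close>

context valued_field
begin

text \<open>Every later term gives the same distance from \<open>s \<nu>\<close>, so
  \<open>t \<nu>\<close> is the difference with an arbitrarily chosen one.\<close>

lemma scaled_sequence_if_convergent:
  fixes s :: "'i::{wellorder,no_top} \<Rightarrow> 'f"
  assumes pc: "pseudo_convergent_on v {M..} s"
  shows "\<exists>t N. scaled_sequence v s t N \<and> increasing_from N t \<and> (\<forall>\<nu>\<ge>N. gauge v s \<nu> = v (t \<nu>))"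
proof -
  let ?N = "tail_start v s"
  obtain next_index :: "'i \<Rightarrow> 'i" where next_index: "\<nu> < next_index \<nu>" for \<nu>
    using gt_ex by metis
  define t where "t \<nu> = s (next_index \<nu>) - s \<nu>" for \<nu>
  have gauge: "gauge v s \<nu> = v (t \<nu>)" if "?N \<le> \<nu>" for \<nu>
    unfolding t_def using gauge_convergent[OF pc that next_index] .
  have inc: "increasing_from ?N t"
    unfolding increasing_from_def using gauge_convergent_less[OF pc] gauge by simp
  have "t \<nu> \<noteq> 0" if "?N \<le> \<nu>" for \<nu>
    using increasing_fromD[OF inc that next_index] nonzero_if_v_less by blast
  hence "scaled_sequence v s t ?N"
    using inc gauge gauge_convergent[OF pc] by unfold_locales auto
  with inc gauge show ?thesis by blast
qed

lemma scaled_sequence_if_divergent: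
  fixes s :: "'i::{wellorder,no_top} \<Rightarrow> 'f"
  assumes pd: "pseudo_divergent_on v {M..} s"
  shows "\<exists>t N. scaled_sequence v s t N \<and> decreasing_from N t \<and> (\<forall>\<nu>\<ge>N. gauge v s \<nu> = v (t \<nu>))"
proof -
  let ?N = "tail_start v s"
  \<comment> \<open>From \<open>L\<close> on, differences with the first term of the tail carry the
    gauge. Nonvanishing follows by strict comparison with \<open>t L\<close>, so the scale starts
    strictly after \<open>L\<close>.\<close>
  obtain L where L: "?N < L" using gt_ex by blast
  obtain N where N: "L < N" using gt_ex by blast
  define t where "t \<nu> = s ?N - s \<nu>" for \<nu>
  have gauge: "gauge v s \<nu> = v (t \<nu>)" if "L \<le> \<nu>" for \<nu>
    unfolding t_def using L that by (intro gauge_divergent[OF pd]) auto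
  have less: "v (t \<rho>) < v (t \<nu>)" if "L \<le> \<nu>" "\<nu> < \<rho>" for \<nu> \<rho>
    using gauge_divergent_less[OF pd, of \<nu> \<rho>] gauge[of \<nu>] gauge[of \<rho>] L that by simp
  hence dec: "decreasing_from N t"
    unfolding decreasing_from_def using N by auto
  have "t \<nu> \<noteq> 0" if "N \<le> \<nu>" for \<nu>
    using less[of L \<nu>] N that nonzero_if_v_less by (metis order_refl order_less_le_trans)
  moreover have "v (s \<rho> - s \<nu>) = v (t \<rho>)" if "N \<le> \<nu>" "\<nu> < \<rho>" for \<nu> \<rho>
    using gauge_divergent[OF pd, of \<nu> \<rho>] gauge[of \<rho>] that L N by (simp add: v_diff_commute)
  ultimately have "scaled_sequence v s t N"
    using dec by unfold_locales auto
  with dec gauge N show ?thesis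
    by (metis order_less_imp_le order_trans)
qed

end

section \<open>The dominating degree\<close>

locale alg_closed_scaled_sequence = scaled_sequence v s t N
  for v :: "'f::alg_closed_field \<Rightarrow> 'g::linordered_ab_group_add extended"
    and s t :: "'i::{wellorder,no_top} \<Rightarrow> 'f" and N :: 'i
begin

abbreviation limit :: "'f \<Rightarrow> bool" where
  "limit z \<equiv> (\<forall>\<^sub>F \<nu> in at_top. v (z - s \<nu>) = v (t \<nu>))"

definition limit_zeros :: "'f poly \<Rightarrow> int" where
  "limit_zeros p = (\<Sum>z | poly p z = 0 \<and> limit z. int (Polynomial.order z p))"

text \<open>This is the counting step for splitting off one root with its full multiplicity.\<close>

lemma limit_zeros_linear_power_mult:
  assumes "poly p x \<noteq> 0" "n > 0"
  shows "limit_zeros ([:- x, 1:] ^ n * p) = limit_zeros p + (if limit x then int n else 0)"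
proof -
  let ?q = "[:- x, 1:] ^ n * p"
  have [simp]: "p \<noteq> 0" using assms by auto
  have "?q \<noteq> 0" by simp
  have order: "Polynomial.order z ?q = (if z = x then n else Polynomial.order z p)" for z
  proof (cases "z = x")
    case True
    thus ?thesis
      using assms by (simp add: order_mult order_power_n_n order_0I)
  next
    case False
    have "Polynomial.order z ([:- x, 1:] ^ n) = 0"
      using False by (intro order_0I) simp
    with False show ?thesis
      by (simp add: order_mult)
  qed
  have fin: "finite {z. poly p z = 0 \<and> limit z}"
    using poly_roots_finite[of p] by (auto intro: finite_subset[rotated])
  have eq: "(\<Sum>z | poly p z = 0 \<and> limit z. int (Polynomial.order z ?q)) = limit_zeros p"
    unfolding limit_zeros_def using assms(1) by (intro sum.cong) (auto simp: order)
  have "{z. poly ?q z = 0 \<and> limit z} = (if limit x then {x} else {}) \<union> {z. poly p z = 0 \<and> limit z}"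
    using assms(2) by auto
  hence "limit_zeros ?q = (\<Sum>z \<in> (if limit x then {x} else {}) \<union> {z. poly p z = 0 \<and> limit z}.
      int (Polynomial.order z ?q))"
    unfolding limit_zeros_def by (rule arg_cong)
  also have "\<dots> = (\<Sum>z \<in> (if limit x then {x} else {}). int (Polynomial.order z ?q)) + limit_zeros p"
    unfolding eq[symmetric] using fin assms(1) by (intro sum.union_disjoint) auto
  also have "(\<Sum>z \<in> (if limit x then {x} else {}). int (Polynomial.order z ?q)) =
      (if limit x then int n else 0)"
    by (simp add: order)
  finally show ?thesis by simp
qed

text \<open>Roots are split off one by one: a root of multiplicity \<open>n\<close> contributes
  \<open>t \<nu> ^ n\<close> if it is a pseudo-limit, and a constant otherwise.\<close>

lemma poly_value:
  assumes "p \<noteq> 0"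
  shows "\<exists>C. C \<noteq> 0 \<and> (\<forall>\<^sub>F \<nu> in at_top. v (poly p (s \<nu>)) = v (C * t \<nu> powi limit_zeros p))"
  using assms
proof (induction p rule: poly_root_order_induct)
  case (no_roots p)
  hence "degree p = 0"
    using alg_closed_imp_poly_has_root[of p] by auto
  then obtain c where "p = [:c:]"
    by (rule degree_eq_zeroE)
  with no_roots show ?case
    by (intro exI[of _ c]) (simp add: limit_zeros_def)
next
  case (root p x n)
  then obtain C where C: "C \<noteq> 0"
    "\<forall>\<^sub>F \<nu> in at_top. v (poly p (s \<nu>)) = v (C * t \<nu> powi limit_zeros p)"
    by auto
  have eq: "v (poly ([:- x, 1:] ^ n * p) y) = v ((x - y) ^ n * poly p y)" for y
  proof -
    have "poly ([:- x, 1:] ^ n * p) y = (y - x) ^ n * poly p y"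
      by simp
    thus ?thesis
      using v_mult_cong[OF v_power_cong[OF v_diff_commute[of y x]] refl] by simp
  qed
  show ?case
  proof (cases "limit x")
    case True
    have "\<forall>\<^sub>F \<nu> in at_top. v (poly ([:- x, 1:] ^ n * p) (s \<nu>)) =
        v (C * t \<nu> powi limit_zeros ([:- x, 1:] ^ n * p))"
      using C(2) True eventually_ge_at_top[of N]
    proof eventually_elim
      case (elim \<nu>)
      have "v (poly ([:- x, 1:] ^ n * p) (s \<nu>)) = v (t \<nu> ^ n * (C * t \<nu> powi limit_zeros p))"
        unfolding eq by (intro v_mult_cong v_power_cong elim)
      also have "t \<nu> ^ n * (C * t \<nu> powi limit_zeros p) = C * t \<nu> powi (limit_zeros p + int n)"
        using t_nonzero[OF elim(3)] by (simp add: power_int_add)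
      finally show ?case
        using root True by (simp add: limit_zeros_linear_power_mult)
    qed
    with C(1) show ?thesis by blast
  next
    case False
    then obtain D where D: "D \<noteq> 0" "\<forall>\<^sub>F \<nu> in at_top. v (x - s \<nu>) = v D"
      using pseudo_limit_or_constant by blast
    from C(2) D(2) have "\<forall>\<^sub>F \<nu> in at_top. v (poly ([:- x, 1:] ^ n * p) (s \<nu>)) =
        v (D ^ n * C * t \<nu> powi limit_zeros ([:- x, 1:] ^ n * p))"
    proof eventually_elim
      case (elim \<nu>)
      have "v (poly ([:- x, 1:] ^ n * p) (s \<nu>)) = v (D ^ n * (C * t \<nu> powi limit_zeros p))"
        unfolding eq by (intro v_mult_cong v_power_cong elim)
      thus ?case
        unfolding limit_zeros_linear_power_mult[OF root(2,1)] using False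
        by (simp add: mult.assoc)
    qed
    with C(1) D(1) show ?thesis
      by (intro exI[of _ "D ^ n * C"]) simp
  qed
qed simp

lemma rational_value:
  assumes "p \<noteq> 0" "q \<noteq> 0"
  shows "\<exists>C. C \<noteq> 0 \<and> (\<forall>\<^sub>F \<nu> in at_top.
    v (poly p (s \<nu>) / poly q (s \<nu>)) = v (C * t \<nu> powi (limit_zeros p - limit_zeros q)))"
proof -
  obtain C D where C: "C \<noteq> 0" "\<forall>\<^sub>F \<nu> in at_top. v (poly p (s \<nu>)) = v (C * t \<nu> powi limit_zeros p)"
    and D: "D \<noteq> 0" "\<forall>\<^sub>F \<nu> in at_top. v (poly q (s \<nu>)) = v (D * t \<nu> powi limit_zeros q)"
    using poly_value[OF assms(1)] poly_value[OF assms(2)] by blast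
  from C(2) D(2) eventually_ge_at_top[of N]
  have "\<forall>\<^sub>F \<nu> in at_top.
    v (poly p (s \<nu>) / poly q (s \<nu>)) = v (C / D * t \<nu> powi (limit_zeros p - limit_zeros q))"
  proof eventually_elim
    case (elim \<nu>)
    have "v (poly p (s \<nu>) / poly q (s \<nu>)) =
        v (C * t \<nu> powi limit_zeros p / (D * t \<nu> powi limit_zeros q))"
      by (intro v_divide_cong elim)
    thus ?case
      using t_nonzero[OF elim(3)] by (simp add: power_int_diff)
  qed
  with C D show ?thesis
    by (intro exI[of _ "C / D"]) simp
qed

end

section \<open>Extensions of valuations\<close>

lemma map_extended_less_iff:
  fixes j :: "'a::linorder \<Rightarrow> 'b::linorder"
  assumes "strict_mono j"
  shows "map_extended j x < map_extended j y \<longleftrightarrow> x < y"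
  using assms by (cases x; cases y) (simp_all add: strict_mono_less)

lemma extends_valuation_less_iff:
  assumes "extends_valuation v \<iota> j u"
  shows "u (\<iota> x) < u (\<iota> y) \<longleftrightarrow> v x < v y"
  using assms by (simp add: extends_valuation_def map_extended_less_iff)

text \<open>Equalities and strict inequalities of values pass through the strictly monotone
  \<open>j\<close>, so the same scale works in the larger field.\<close>

lemma scaled_sequence_extension:
  fixes \<iota> :: "'k::field \<Rightarrow> 'f::field"
  assumes ext: "extends_valuation v \<iota> j u" and "scaled_sequence v s t N"
    and diff: "\<And>x y. \<iota> (x - y) = \<iota> x - \<iota> y" and zero: "\<And>x. \<iota> x = 0 \<longleftrightarrow> x = 0"
  shows "scaled_sequence u (\<lambda>\<nu>. \<iota> (s \<nu>)) (\<lambda>\<nu>. \<iota> (t \<nu>)) N"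
proof -
  interpret scaled_sequence v s t N by fact
  interpret u: valued_field u
    using ext by unfold_locales (simp add: extends_valuation_def)
  have u: "u (\<iota> x) = map_extended j (v x)" for x
    using ext by (simp add: extends_valuation_def)
  show ?thesis
  proof
    show "u.increasing_from N (\<lambda>\<nu>. \<iota> (t \<nu>)) \<and> (\<forall>\<nu>\<ge>N. \<forall>\<rho>>\<nu>. u (\<iota> (s \<rho>) - \<iota> (s \<nu>)) = u (\<iota> (t \<nu>))) \<or>
      u.decreasing_from N (\<lambda>\<nu>. \<iota> (t \<nu>)) \<and> (\<forall>\<nu>\<ge>N. \<forall>\<rho>>\<nu>. u (\<iota> (s \<rho>) - \<iota> (s \<nu>)) = u (\<iota> (t \<rho>)))"
      using kind unfolding u.increasing_from_def u.decreasing_from_def increasing_from_def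
        decreasing_from_def extends_valuation_less_iff[OF ext]
      by (auto simp: u diff[symmetric])
  qed (simp add: zero t_nonzero)
qed

section \<open>Evaluation of rational functions\<close>

text \<open>A denominator of least degree works: cancelling a common factor of positive degree would
  lower the degree further.\<close>

lemma coprime_fraction_exists:
  fixes \<phi> :: "'k::field poly fract"
  shows "\<exists>p q. q \<noteq> 0 \<and> coprime p q \<and> \<phi> = Fraction_Field.Fract p q"
proof -
  let ?P = "\<lambda>n. \<exists>p q. q \<noteq> 0 \<and> \<phi> = Fraction_Field.Fract p q \<and> degree q = n"
  have "\<exists>n. ?P n"
    by (cases \<phi>) blast
  then obtain n where n: "?P n" "\<And>m. m < n \<Longrightarrow> \<not> ?P m"
    using exists_least_iff[of ?P] by blast
  then obtain p q where q: "q \<noteq> 0" "\<phi> = Fraction_Field.Fract p q" "degree q = n"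
    by blast
  have "coprime p q"
  proof (rule coprimeI)
    fix d assume "d dvd p" "d dvd q"
    then obtain p' q' where d: "p = d * p'" "q = d * q'"
      by (elim dvdE)
    have [simp]: "d \<noteq> 0" "q' \<noteq> 0"
      using d q(1) by auto
    have "\<phi> = Fraction_Field.Fract p' q'"
      using q(2) d by (simp add: eq_fract)
    hence "\<not> degree q' < n"
      using n(2)[of "degree q'"] \<open>q' \<noteq> 0\<close> by blast
    hence "degree d = 0"
      using q(3) d by (simp add: degree_mult_eq)
    thus "is_unit d"
      by (simp add: is_unit_iff_degree)
  qed
  with q show ?thesis by blast
qed

lemma reduced_fraction:
  fixes \<phi> :: "'k::field poly fract"
  shows "denominator \<phi> \<noteq> 0" "\<phi> = Fraction_Field.Fract (numerator \<phi>) (denominator \<phi>)"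
proof -
  have "\<exists>x. (\<lambda>(p, q). q \<noteq> 0 \<and> coprime p q \<and> \<phi> = Fraction_Field.Fract p q) x"
    using coprime_fraction_exists[of \<phi>] by auto
  hence "(\<lambda>(p, q). q \<noteq> 0 \<and> coprime p q \<and> \<phi> = Fraction_Field.Fract p q) (reduced_fraction \<phi>)"
    unfolding reduced_fraction_def by (rule someI_ex)
  thus "denominator \<phi> \<noteq> 0" "\<phi> = Fraction_Field.Fract (numerator \<phi>) (denominator \<phi>)"
    by (simp_all add: numerator_def denominator_def case_prod_beta)
qed

text \<open>\<open>eval_fract\<close> uses a fraction in lowest terms; any other representation
  agrees with it where neither denominator vanishes.\<close>

lemma eventually_eval_fract:
  assumes "q \<noteq> 0" and "\<And>r. r \<noteq> 0 \<Longrightarrow> \<forall>\<^sub>F \<nu> in F. poly r (s \<nu>) \<noteq> 0"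
  shows "\<forall>\<^sub>F \<nu> in F. eval_fract (Fraction_Field.Fract p q) (s \<nu>) = poly p (s \<nu>) / poly q (s \<nu>)"
proof -
  let ?\<phi> = "Fraction_Field.Fract p q"
  have "p * denominator ?\<phi> = numerator ?\<phi> * q"
    using reduced_fraction[of ?\<phi>] assms(1) by (simp add: eq_fract)
  hence eq: "poly p x * poly (denominator ?\<phi>) x = poly (numerator ?\<phi>) x * poly q x" for x
    by (metis poly_mult)
  from assms(2)[OF assms(1)] assms(2)[OF reduced_fraction(1)[of ?\<phi>]] show ?thesis
    by eventually_elim (use eq in \<open>simp add: eval_fract_def field_simps\<close>)
qed

lemma poly_map_to_ac: "poly (map_poly to_ac p) (to_ac x) = to_ac (poly p x)"
  by (induction p) (auto simp: map_poly_pCons)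

text \<open>This identifies \<open>degdom\<close> with the slope: the roots counted are exactly
  those whose distances to \<open>s\<close> eventually follow \<open>t\<close>.\<close>

lemma degdom_value:
  fixes v :: "'k::field \<Rightarrow> 'g::linordered_ab_group_add extended"
    and u :: "'k alg_closure \<Rightarrow> 'h::linordered_ab_group_add extended"
    and s t :: "'i::{wellorder,no_top} \<Rightarrow> 'k"
  assumes ext: "extends_valuation v to_ac j u" and scaled: "scaled_sequence v s t N"
    and gauge: "\<And>\<nu>. N \<le> \<nu> \<Longrightarrow> gauge v s \<nu> = v (t \<nu>)" and "numerator \<phi> \<noteq> 0"
  shows "\<exists>C. C \<noteq> 0 \<and> (\<forall>\<^sub>F \<nu> in at_top.
    u (to_ac (eval_fract \<phi> (s \<nu>))) = u (C * to_ac (t \<nu>) powi degdom v j u s \<phi>))"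
proof -
  interpret scaled_sequence u "\<lambda>\<nu>. to_ac (s \<nu>)" "\<lambda>\<nu>. to_ac (t \<nu>)" N
    by (rule scaled_sequence_extension[OF ext scaled]) simp_all
  interpret alg_closed_scaled_sequence u "\<lambda>\<nu>. to_ac (s \<nu>)" "\<lambda>\<nu>. to_ac (t \<nu>)" N ..
  have "\<forall>\<^sub>F \<nu> in at_top. map_extended j (gauge v s \<nu>) = u (to_ac (t \<nu>))"
    using eventually_ge_at_top[of N]
    by eventually_elim (use ext gauge in \<open>simp add: extends_valuation_def\<close>)
  hence limit: "pseudo_limit v to_ac j u s z \<longleftrightarrow> limit z" for z
    unfolding pseudo_limit_def by (intro eventually_subst) (auto elim!: eventually_mono)
  have "degdom v j u s \<phi> =
      limit_zeros (map_poly to_ac (numerator \<phi>)) - limit_zeros (map_poly to_ac (denominator \<phi>))"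
    by (simp add: degdom_def limit_zeros_def limit Let_def)
  moreover have "map_poly to_ac p \<noteq> 0" if "p \<noteq> 0" for p :: "'k poly"
    using that by (simp add: map_poly_eq_0_iff)
  ultimately show ?thesis
    using rational_value[of "map_poly to_ac (numerator \<phi>)" "map_poly to_ac (denominator \<phi>)"]
      assms(4) reduced_fraction(1)[of \<phi>]
    by (simp add: poly_map_to_ac eval_fract_def)
qed

section \<open>The function \<phi> as a pseudo-limit of its values\<close>

lemma pseudo_limit_rational_function:
  fixes v :: "'k::field \<Rightarrow> 'g::linordered_ab_group_add extended"
    and w :: "'k poly fract \<Rightarrow> 'l::linordered_ab_group_add extended"
    and s :: "'i::{wellorder,no_top} \<Rightarrow> 'k"
  assumes V: "valuation_domain_with V v" and W: "valuation_domain_with (sequence_ring V s) w"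
    and ext: "extends_valuation v const_fract j w"
    and nonzero: "\<And>r. r \<noteq> 0 \<Longrightarrow> \<forall>\<^sub>F \<nu> in at_top. poly r (s \<nu>) \<noteq> 0"
    and nonconst: "\<And>c. numerator \<phi> \<noteq> smult c (denominator \<phi>)"
    and conv: "eventually_pseudo_convergent v (\<lambda>\<nu>. eval_fract \<phi> (s \<nu>))"
  shows "pseudo_limit v const_fract j w (\<lambda>\<nu>. eval_fract \<phi> (s \<nu>)) \<phi>"
proof -
  interpret valued_field v
    using V by unfold_locales (simp add: valuation_domain_with_def)
  interpret w: valued_field w
    using W by unfold_locales (simp add: valuation_domain_with_def)
  define r where "r = (\<lambda>\<nu>. eval_fract \<phi> (s \<nu>))"
  define p q where "p = numerator \<phi>" and "q = denominator \<phi>"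
  have q: "q \<noteq> 0" and \<phi>: "\<phi> = Fraction_Field.Fract p q" and r: "r \<nu> = poly p (s \<nu>) / poly q (s \<nu>)" for \<nu>
    using reduced_fraction[of \<phi>] by (auto simp: p_def q_def r_def eval_fract_def)
  obtain M where pc: "pseudo_convergent_on v {M..} r"
    using conv by (auto simp: eventually_pseudo_convergent_def r_def)
  have "\<forall>\<^sub>F \<nu> in at_top. w (\<phi> - const_fract (r \<nu>)) = map_extended j (gauge v r \<nu>)"
    using eventually_ge_at_top[of "tail_start v r"]
  proof eventually_elim
    case (elim \<nu>)
    obtain \<rho> where \<rho>: "\<nu> < \<rho>" using gt_ex by blast
    define c where "c = r \<nu>"
    define d where "d = r \<rho> - r \<nu>"
    have gauge: "gauge v r \<nu> = v d"
      unfolding d_def using gauge_convergent[OF pc elim \<rho>] .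
    have "v d < gauge v r \<rho>"
      using gauge_convergent_less[OF pc elim \<rho>] gauge by simp
    hence d: "d \<noteq> 0" by auto
    \<comment> \<open>The fraction \<open>a / b\<close> is \<open>(\<phi> - c) / d\<close> with the
      denominator of \<phi> cleared.\<close>
    define a where "a = p - smult c q"
    define b where "b = smult d q"
    have nz: "a \<noteq> 0" "b \<noteq> 0"
      using nonconst q d by (auto simp: p_def q_def a_def b_def)
    let ?\<psi> = "Fraction_Field.Fract a b"
    have v_eq: "\<forall>\<^sub>F \<sigma> in at_top. v (poly a (s \<sigma>)) = v (poly b (s \<sigma>))"
      using nonzero[OF q] eventually_gt_at_top[of \<nu>]
    proof eventually_elim
      case (elim \<sigma>)
      \<comment> \<open>Both \<rho> and \<sigma> lie after \<nu>, so the two differences from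
        \<open>r \<nu>\<close> realise the same gauge.\<close>
      have "v (r \<sigma> - c) = v d"
        unfolding c_def gauge[symmetric]
        using gauge_convergent[OF pc \<open>tail_start v r \<le> \<nu>\<close> elim(2)] by simp
      hence "v ((r \<sigma> - c) * poly q (s \<sigma>)) = v (d * poly q (s \<sigma>))"
        by (intro v_mult_cong refl)
      moreover have "(r \<sigma> - c) * poly q (s \<sigma>) = poly a (s \<sigma>)"
        using elim by (simp add: a_def r field_simps)
      ultimately show ?case by (simp add: b_def)
    qed
    \<comment> \<open>Stated for arbitrary \<open>x\<close> and \<open>y\<close> so that it covers
      both \<open>a / b\<close> and its inverse.\<close>
    have unit: "Fraction_Field.Fract x y \<in> sequence_ring V s"
      if "y \<noteq> 0" "\<forall>\<^sub>F \<sigma> in at_top. v (poly x (s \<sigma>)) = v (poly y (s \<sigma>))" for x y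
    proof -
      have "\<forall>\<^sub>F \<sigma> in at_top.
          eval_fract (Fraction_Field.Fract x y) (s \<sigma>) = poly x (s \<sigma>) / poly y (s \<sigma>)"
        by (rule eventually_eval_fract[OF that(1) nonzero])
      from this that(2) nonzero[OF that(1)]
      have "\<forall>\<^sub>F \<sigma> in at_top. eval_fract (Fraction_Field.Fract x y) (s \<sigma>) \<in> V"
      proof eventually_elim
        case (elim \<sigma>)
        have "v (poly x (s \<sigma>) / poly y (s \<sigma>)) = v (poly y (s \<sigma>) / poly y (s \<sigma>))"
          by (intro v_divide_cong elim refl)
        with elim V show ?case
          by (simp add: valuation_domain_with_def)
      qed
      thus ?thesis by (simp add: sequence_ring_def)
    qed
    have "?\<psi> \<in> sequence_ring V s" "inverse ?\<psi> \<in> sequence_ring V s"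
      using unit[OF nz(2) v_eq] unit[OF nz(1)] v_eq by (simp_all add: eq_commute)
    moreover have "?\<psi> \<noteq> 0"
      using nz by (simp add: Zero_fract_def eq_fract)
    ultimately have "w ?\<psi> = 0"
      using W by (intro w.v_eq_0_if_nonneg) (auto simp: valuation_domain_with_def)
    moreover have "\<phi> - const_fract c = const_fract d * ?\<psi>"
      using q d by (simp add: \<phi> const_fract_def a_def b_def eq_fract algebra_simps)
    ultimately have "w (\<phi> - const_fract c) = w (const_fract d)"
      by (simp add: w.v_mult)
    thus ?case
      using ext by (simp add: gauge c_def extends_valuation_def)
  qed
  thus ?thesis by (simp add: pseudo_limit_def r_def)
qed

theorem proposition3p8:
  fixes V :: "'k::field set"
    and v :: "'k \<Rightarrow> 'g::linordered_ab_group_add extended"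
    and s :: "'i::{wellorder,no_top} \<Rightarrow> 'k"
    and \<phi> :: "'k poly fract"
  assumes "valuation_domain_with V v"
    and "strictly_pseudo_monotone_on v UNIV s"
    and "\<phi> \<notin> range const_fract"
  shows "eventually_strictly_pseudo_monotone v (\<lambda>\<nu>. eval_fract \<phi> (s \<nu>)) \<and>
    (\<forall>(u :: 'k alg_closure \<Rightarrow> 'h::linordered_ab_group_add extended) j.
       extends_valuation v to_ac j u \<longrightarrow>
         (degdom v j u s \<phi> > 0 \<longrightarrow> same_kind v s (\<lambda>\<nu>. eval_fract \<phi> (s \<nu>))) \<and>
         (degdom v j u s \<phi> < 0 \<longrightarrow> \<not> same_kind v s (\<lambda>\<nu>. eval_fract \<phi> (s \<nu>))) \<and>
         (degdom v j u s \<phi> \<noteq> 0 \<longrightarrow>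
            pseudo_limits v (\<lambda>\<nu>. eval_fract \<phi> (s \<nu>)) =
            breadth_ideal v (\<lambda>\<nu>. eval_fract \<phi> (s \<nu>)))) \<and>
    (eventually_pseudo_convergent v (\<lambda>\<nu>. eval_fract \<phi> (s \<nu>)) \<longrightarrow>
       (\<forall>(w :: 'k poly fract \<Rightarrow> 'l::linordered_ab_group_add extended) j.
          valuation_domain_with (sequence_ring V s) w \<and> extends_valuation v const_fract j w \<longrightarrow>
            pseudo_limit v const_fract j w (\<lambda>\<nu>. eval_fract \<phi> (s \<nu>)) \<phi>))"
proof -
  interpret valued_field v
    using assms(1) by unfold_locales (simp add: valuation_domain_with_def)
  define r where "r = (\<lambda>\<nu>. eval_fract \<phi> (s \<nu>))"
  \<comment> \<open>The least index turns the whole sequence into a tail, the form in which the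
    preceding results are stated.\<close>
  define N0 :: 'i where "N0 = (LEAST x. True)"
  have UNIV_eq: "UNIV = {N0..}"
    by (auto simp: N0_def intro: Least_le)
  have "\<exists>t N. scaled_sequence v s t N \<and> (\<forall>\<nu>\<ge>N. gauge v s \<nu> = v (t \<nu>)) \<and>
    (increasing_from N t \<and> pseudo_convergent_on v {N0..} s \<or>
     decreasing_from N t \<and> pseudo_divergent_on v {N0..} s)"
    using assms(2) scaled_sequence_if_convergent[of N0 s] scaled_sequence_if_divergent[of N0 s]
    unfolding UNIV_eq strictly_pseudo_monotone_on_def by blast
  then obtain t N where scaled: "scaled_sequence v s t N"
    and gauge: "\<And>\<nu>. N \<le> \<nu> \<Longrightarrow> gauge v s \<nu> = v (t \<nu>)"
    and s_kind: "increasing_from N t \<and> pseudo_convergent_on v {N0..} s \<or>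
      decreasing_from N t \<and> pseudo_divergent_on v {N0..} s"
    by blast
  interpret scaled_sequence v s t N by fact
  obtain a :: "'i \<Rightarrow> 'k" and F N' where "pseudo_approximation v s t a F N'"
    using pseudo_approximation_exists by blast
  then interpret approx: pseudo_approximation v s t a F N' .
  have nonconst: "numerator \<phi> \<noteq> smult c (denominator \<phi>)" for c
  proof
    assume "numerator \<phi> = smult c (denominator \<phi>)"
    hence "\<phi> = Fraction_Field.Fract (smult c (denominator \<phi>)) (denominator \<phi>)"
      using reduced_fraction(2)[of \<phi>] by simp
    also have "\<dots> = const_fract c"
      using reduced_fraction(1)[of \<phi>] by (simp add: const_fract_def eq_fract)
    finally have "\<phi> = const_fract c" .
    with assms(3) show False by blast
  qed
  have num: "numerator \<phi> \<noteq> 0"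
    using nonconst[of 0] by simp
  have "eventually_strictly_pseudo_monotone v r"
    by (rule approx.rational_eventually_strictly_pseudo_monotone[OF num reduced_fraction(1)[of \<phi>]
          nonconst]) (simp add: r_def eval_fract_def)
  moreover have "(degdom v j u s \<phi> > 0 \<longrightarrow> same_kind v s r) \<and>
      (degdom v j u s \<phi> < 0 \<longrightarrow> \<not> same_kind v s r) \<and>
      (degdom v j u s \<phi> \<noteq> 0 \<longrightarrow> pseudo_limits v r = breadth_ideal v r)"
    if ext: "extends_valuation v to_ac j u"
    for u :: "'k alg_closure \<Rightarrow> 'h extended" and j
  proof -
    interpret u: valued_field u
      using ext by unfold_locales (simp add: extends_valuation_def)
    let ?d = "degdom v j u s \<phi>" and ?t = "\<lambda>\<nu>. to_ac (t \<nu>)"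
    \<comment> \<open>Only the constant \<open>C\<close> below may lie outside \<open>K\<close>;
      monotonicity of \<open>r\<close> is obtained under \<open>u\<close> and then pulled back to
      \<open>v\<close>.\<close>
    have transfer: "u.increasing_from M (\<lambda>\<nu>. to_ac (f \<nu>)) \<longleftrightarrow> increasing_from M f"
         "u.decreasing_from M (\<lambda>\<nu>. to_ac (f \<nu>)) \<longleftrightarrow> decreasing_from M f" for M and f :: "'i \<Rightarrow> 'k"
      by (simp_all add: u.increasing_from_def u.decreasing_from_def increasing_from_def
          decreasing_from_def extends_valuation_less_iff[OF ext])
    obtain C where C: "C \<noteq> 0"
      "\<forall>\<^sub>F \<nu> in at_top. u (to_ac (r \<nu>)) = u (C * ?t \<nu> powi ?d)"
      using degdom_value[OF ext scaled gauge num] unfolding r_def by blast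
    have inc_r: "\<exists>M. increasing_from M r" if "u.increasing_from N (\<lambda>\<nu>. ?t \<nu> powi ?d)"
      using u.increasing_from_if_value_eq[OF that C] unfolding transfer .
    have dec_r: "\<exists>M. decreasing_from M r" if "u.decreasing_from N (\<lambda>\<nu>. ?t \<nu> powi ?d)"
      using u.decreasing_from_if_value_eq[OF that C] unfolding transfer .
    have t_nz: "?t \<nu> \<noteq> 0" if "N \<le> \<nu>" for \<nu>
      using t_nonzero[OF that] by simp
    have conv: "eventually_pseudo_convergent v r" "pseudo_limits v r = breadth_ideal v r"
      if "increasing_from M r" for M
      using increasing_from_imp_pseudo_convergent[OF that] increasing_from_pseudo_limits[OF that]
      by (auto simp: eventually_pseudo_convergent_def)
    have div: "eventually_pseudo_divergent v r" "pseudo_limits v r = breadth_ideal v r"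
      if "decreasing_from M r" for M
      using decreasing_from_imp_pseudo_divergent[OF that] decreasing_from_pseudo_limits[OF that]
      by (auto simp: eventually_pseudo_divergent_def)
    \<comment> \<open>For negative degree, \<open>same_kind\<close> is refuted from opposite kinds,
      which requires that no sequence be of both kinds.\<close>
    have excl: "\<not> (eventually_pseudo_convergent v x \<and> eventually_pseudo_divergent v x)"
      for x :: "'i \<Rightarrow> 'k"
      using pseudo_convergent_not_divergent
      by (auto simp: eventually_pseudo_convergent_def eventually_pseudo_divergent_def)
    from s_kind show ?thesis
    proof
      assume *: "increasing_from N t \<and> pseudo_convergent_on v {N0..} s"
      hence s: "eventually_pseudo_convergent v s"
        by (auto simp: eventually_pseudo_convergent_def)
      \<comment> \<open>A positive slope keeps the direction of \<open>t\<close>, a negative one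
        reverses it; for slope 0 the three implications are vacuous.\<close>
      consider "?d = 0" | "?d > 0" "\<exists>M. increasing_from M r" | "?d < 0" "\<exists>M. decreasing_from M r"
        using * inc_r dec_r t_nz u.increasing_from_powi[of N ?t ?d]
          u.increasing_from_powi_neg[of N ?t ?d] transfer linorder_less_linear[of ?d 0] by blast
      thus ?thesis
      proof cases
        case 2
        then obtain M where "increasing_from M r" by blast
        from conv[OF this] show ?thesis
          using 2(1) s by (simp add: same_kind_def)
      next
        case 3
        then obtain M where "decreasing_from M r" by blast
        from div[OF this] show ?thesis
          using 3(1) s excl[of r] excl[of s] by (auto simp: same_kind_def)
      qed simp
    next
      assume *: "decreasing_from N t \<and> pseudo_divergent_on v {N0..} s"
      hence s: "eventually_pseudo_divergent v s"
        by (auto simp: eventually_pseudo_divergent_def)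
      consider "?d = 0" | "?d > 0" "\<exists>M. decreasing_from M r" | "?d < 0" "\<exists>M. increasing_from M r"
        using * inc_r dec_r t_nz u.decreasing_from_powi[of N ?t ?d]
          u.decreasing_from_powi_neg[of N ?t ?d] transfer linorder_less_linear[of ?d 0] by blast
      thus ?thesis
      proof cases
        case 2
        then obtain M where "decreasing_from M r" by blast
        from div[OF this] show ?thesis
          using 2(1) s by (simp add: same_kind_def)
      next
        case 3
        then obtain M where "increasing_from M r" by blast
        from conv[OF this] show ?thesis
          using 3(1) s excl[of r] excl[of s] by (auto simp: same_kind_def)
      qed simp
    qed
  qed
  moreover have "pseudo_limit v const_fract j w r \<phi>"
    if "eventually_pseudo_convergent v r" "valuation_domain_with (sequence_ring V s) w"
      "extends_valuation v const_fract j w"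
    for w :: "'k poly fract \<Rightarrow> 'l extended" and j
    using pseudo_limit_rational_function[OF assms(1) that(2,3) approx.eventually_poly_nonzero
        nonconst] that(1) unfolding r_def by blast
  ultimately show ?thesis
    unfolding r_def by blast
qed

end
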